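(* Let $\alpha,\beta,x,y,s\in\mathbb{C}$ with $\mathrm{Re}(\alpha)>-1$, $\mathrm{Re}(s)>0$, $\mathrm{Re}(x+s)>0$ and $\mathrm{Re}(y+s)>0$ (and with $\mathrm{Re}(p)>0$ for the parameter $p$ of the $\Psi$-beta function, which is the variable of the Mellin transform). Then the Mellin transform with respect to $p$ of the $\Psi$-beta function is $$\mathcal{M}\left\lbrace {}^{\Psi}B_{p}^{(\alpha,\beta)}(x,y)\right\rbrace =\int_{0}^{\infty}p^{s-1}\,{}^{\Psi}B_{p}^{(\alpha,\beta)}(x,y)\,dp = B(x+s,y+s)\;{}^{\Psi}\Gamma^{(\alpha,\beta)}(s).$$
   Context: For $\alpha,\beta\in\mathbb{C}$ with $\mathrm{Re}(\alpha)>-1$, the Wright function is ${}_{0}\Psi_{1}(\alpha,\beta;z)=\sum_{n=0}^{\infty}\frac{1}{\Gamma(\alpha n+\beta)}\frac{z^n}{n!}$ (with $1/\Gamma$ equal to $0$ at the poles of $\Gamma$). The $\Psi$-beta function is $${}^{\Psi}B_{p}^{(\alpha,\beta)}(x,y)=\int_{0}^{1}t^{x-1}(1-t)^{y-1}\,{}_{0}\Psi_{1}\left(\alpha,\beta;-\frac{p}{t(1-t)}\right)dt,$$ introduced for $\mathrm{Re}(x)>0$, $\mathrm{Re}(y)>0$, $\mathrm{Re}(\alpha)>-1$, $\mathrm{Re}(p)>0$; in the claim the same integral formula is used for the parameters considered. The $\Psi$-gamma function is ${}^{\Psi}\Gamma_{p}^{(\alpha,\beta)}(x)=\int_{0}^{\infty}t^{x-1}\,{}_{0}\Psi_{1}\left(\alpha,\beta;-t-\frac{p}{t}\right)dt$,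 and ${}^{\Psi}\Gamma^{(\alpha,\beta)}(s)$ denotes its case $p=0$, i.e. ${}^{\Psi}\Gamma^{(\alpha,\beta)}(s)=\int_{0}^{\infty}v^{s-1}\,{}_{0}\Psi_{1}(\alpha,\beta;-v)\,dv$. $B(\cdot,\cdot)$ is the classical Euler beta function.
   Formalization: The formal theorem also assumes that the integral defining ΨΓ^{(α,β)}(s) converges (possibly conditionally); this fails for some admitted parameters, e.g. α=β=s=1, where the right-hand side is undefined. *)

theory Defs
  imports "HOL-Analysis.Analysis"
begin

text \<open>
  All integrals are Henstock--Kurzweil integrals. On a half-line or an open interval these agree
  with the Lebesgue integral of an absolutely integrable function, and also with the conditionally
  convergent improper integral. Conditional convergence does occur here: for \<open>\<alpha> = 1\<close> the Wright
  function at \<open>-v\<close> is \<open>v powr ((1 - \<beta>) / 2)\<close> times the oscillating Bessel function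
  \<open>J\<close> of order \<open>\<beta> - 1\<close> at \<open>2 * sqrt v\<close>.
\<close>

text \<open>\<^const>\<open>rGamma\<close> is the entire function \<open>1/\<Gamma>\<close>, which is \<open>0\<close> at the poles of \<open>\<Gamma>\<close>.\<close>

definition wright :: "complex \<Rightarrow> complex \<Rightarrow> complex \<Rightarrow> complex" where
  "wright \<alpha> \<beta> z = (\<Sum>n. rGamma (\<alpha> * of_nat n + \<beta>) * (z ^ n / fact n))"

definition psi_beta :: "complex \<Rightarrow> complex \<Rightarrow> complex \<Rightarrow> complex \<Rightarrow> complex \<Rightarrow> complex" where
  "psi_beta \<alpha> \<beta> p x y =
     integral {0<..<1} (\<lambda>t::real. of_real t powr (x - 1) * (1 - of_real t) powr (y - 1)
        * wright \<alpha> \<beta> (- (p / (of_real t * (1 - of_real t)))))"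

definition psi_gamma :: "complex \<Rightarrow> complex \<Rightarrow> complex \<Rightarrow> complex \<Rightarrow> complex" where
  "psi_gamma \<alpha> \<beta> p x =
     integral {0<..} (\<lambda>t::real. of_real t powr (x - 1) * wright \<alpha> \<beta> (- of_real t - p / of_real t))"

definition mellin :: "(real \<Rightarrow> complex) \<Rightarrow> complex \<Rightarrow> complex" where
  "mellin f s = integral {0<..} (\<lambda>p::real. of_real p powr (s - 1) * f p)"

end

theory Submission
  imports Defs "HOL-Real_Asymp.Real_Asymp"
begin

text \<open>
Formally, the identity is an exchange of integrals: for fixed \<open>t\<close> and \<open>w = t * (1 - t)\<close>, the
substitution \<open>p = w * v\<close> gives
\<open>\<integral> p powr (s - 1) * W (p / w) dp = w powr s * \<Psi>\<close>, where \<open>W v\<close> is the Wright function at \<open>-v\<close> and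
\<open>\<Psi>\<close> its Mellin transform at \<open>s\<close>. The power of \<open>w\<close> then shifts the parameters of the Beta integral
by \<open>s\<close>. But \<open>\<Psi>\<close> may converge only conditionally, and with it the integral over \<open>t\<close>, so Fubini's
theorem is not available.

The exchange is therefore done at the level of primitives. Let \<open>G v\<close> be the integral of
\<open>u powr (s - 1) * W u\<close> over \<open>{0..v}\<close>; it is continuous, bounded, vanishes at 0 and tends to \<open>\<Psi>\<close>.
The function \<open>H p = \<integral> t powr (x + s - 1) * (1 - t) powr (y + s - 1) * G (p / w) dt\<close> converges absolutely
because \<open>x + s\<close> and \<open>y + s\<close> have positive real parts. By dominated convergence it is continuous,
\<open>H 0 = 0\<close>, and \<open>H p\<close> tends to \<open>\<Psi>\<close> times the Beta integral as \<open>p\<close> grows. So the theorem reduces to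
the claim that \<open>H\<close> has derivative \<open>p powr (s - 1)\<close> times the \<open>\<Psi>\<close>-beta function
(\<open>H_has_vector_derivative\<close>) together with the fundamental theorem of calculus on the half-line
(\<open>has_integral_0_infinity\<close>).

Differentiation under the integral sign needs control near \<open>t = 0\<close> that is uniform in \<open>p\<close>. It comes
from an integration by parts in \<open>t\<close> (\<open>\<phi>_tail\<close>), which trades the oscillating \<open>W\<close> for the bounded
\<open>G\<close>; the same estimate proves that the \<open>\<Psi>\<close>-beta integral converges. The interval is cut at its
midpoint and the right half reflected, so that a single singularity is treated at a time.

Two facts about special functions are needed besides. The Wright function is continuous: for
\<open>Re \<alpha> > -1\<close> its series converges everywhere (\<open>summable_wright\<close>), which rests on a growth bound for
\<open>1/\<Gamma>\<close>. And the Beta integral must be evaluated for complex parameters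
(\<open>has_integral_Beta_complex\<close>).
\<close>

section \<open>Growth of the reciprocal Gamma function and the Wright series\<close>

lemma continuous_on_compact_norm_bound:
  fixes f :: "'a::topological_space \<Rightarrow> 'b::real_normed_vector"
  assumes "continuous_on S f" "compact S"
  obtains B where "B > 0" "\<And>x. x \<in> S \<Longrightarrow> norm (f x) \<le> B"
proof -
  have "bounded (f ` S)" using assms by (intro compact_imp_bounded compact_continuous_image)
  thus thesis using that unfolding bounded_pos by blast
qed

lemma Re_nonpos_Ints:
  fixes w :: complex
  assumes "w \<in> \<int>\<^sub>\<le>\<^sub>0"
  shows "Re w \<le> 0"
  using assms by (auto elim!: nonpos_Ints_cases)

lemma norm_of_real_powr:
  fixes z :: complex
  assumes "t \<ge> 0"
  shows "norm (of_real t powr z) = t powr Re z"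
  using assms by (cases "t = 0") (auto simp: norm_powr_real_powr)

text \<open>
In Euler's integral, with \<open>\<sigma> = Re z - 1\<close>, the modulus of the integrand is
\<open>(t powr \<sigma> * exp (- t / 2)) * exp (- t / 2)\<close>. The first factor is at most \<open>(2 * X + 1) powr X\<close>,
the second integrates to 2. The bound is a crude form of Stirling's formula, but it has the
exponent \<open>X\<close> that decides the convergence of the Wright series.
\<close>
lemma norm_Gamma_le:
  fixes z :: complex and X :: real
  assumes "1 \<le> Re z" "Re z \<le> 1 + X"
  shows "norm (Gamma z) \<le> 2 * (2 * X + 1) powr X"
proof -
  have X: "X \<ge> 0" using assms by simp
  define C where "C = (2 * X + 1) powr X"
  have I1: "((\<lambda>t. of_real t powr (z - 1) / of_real (exp t)) has_integral Gamma z) {0..}"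
    by (rule Gamma_integral_complex) (use assms in auto)
  have I2: "((\<lambda>t::real. C * exp (- (1/2) * t)) has_integral C * (exp (- (1/2) * 0) / (1/2))) {0..}"
    by (intro has_integral_mult_right has_integral_exp_minus_to_infinity) auto
  have le: "norm (of_real t powr (z - 1) / of_real (exp t)) \<le> C * exp (- (1/2) * t)"
    if t: "t \<in> {0..}" for t :: real
  proof -
    define \<sigma> where "\<sigma> = Re z - 1"
    have \<sigma>: "0 \<le> \<sigma>" "\<sigma> \<le> X" using assms by (auto simp: \<sigma>_def)
    \<comment> \<open>With \<open>t = (2 * X + 1) * u\<close>, the bound \<open>u \<le> exp u\<close> raised to the power \<open>\<sigma>\<close> costs \<open>exp (\<sigma> * u)\<close>,
        which the scaling keeps below \<open>exp (t / 2)\<close>.\<close>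
    define u where "u = t / (2 * X + 1)"
    have u: "u \<ge> 0" "t = (2 * X + 1) * u" using t X by (auto simp: u_def)
    have "t powr \<sigma> = (2 * X + 1) powr \<sigma> * u powr \<sigma>"
      using u X by (simp add: powr_mult)
    also have "\<dots> \<le> C * exp (t / 2)"
    proof (intro mult_mono)
      show "(2 * X + 1) powr \<sigma> \<le> C" unfolding C_def using \<sigma> X by (intro powr_mono) auto
      have "u \<le> exp u" using exp_ge_add_one_self[of u] by linarith
      hence "u powr \<sigma> \<le> exp u powr \<sigma>" using u \<sigma> by (intro powr_mono2) auto
      also have "\<dots> = exp (\<sigma> * u)" by (simp add: powr_def)
      also have "\<sigma> * u \<le> (X + 1 / 2) * u" using u \<sigma> by (intro mult_right_mono) auto
      hence "exp (\<sigma> * u) \<le> exp (t / 2)" using u(2) by (simp add: algebra_simps)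
      finally show "u powr \<sigma> \<le> exp (t / 2)" .
    qed (auto simp: C_def)
    finally have "t powr \<sigma> / exp t \<le> C * exp (t / 2) / exp t"
      by (intro divide_right_mono) auto
    also have "\<dots> = C * exp (- (1/2) * t)" 
      by (simp add: exp_minus field_simps flip: exp_add)
    finally show ?thesis using t
      by (auto simp: norm_divide norm_of_real_powr \<sigma>_def)
  qed
  have "norm (integral {0..} (\<lambda>t. of_real t powr (z - 1) / of_real (exp t)))
          \<le> integral {0..} (\<lambda>t. C * exp (- (1/2) * t))"
    by (intro integral_norm_bound_integral has_integral_integrable[OF I1] has_integral_integrable[OF I2] le)
  hence "norm (Gamma z) \<le> C * (exp (- (1/2) * 0) / (1/2))"
    using I1 I2 by (simp only: integral_unique)
  thus ?thesis by (simp add: C_def)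
qed

text \<open>
The reflection formula turns \<open>1/\<Gamma>\<close> in the left half-plane into \<open>\<Gamma> (1 - z)\<close>, which
the previous bound controls, times a sine of exponential growth in the imaginary direction.
\<close>
lemma norm_rGamma_le_left:
  fixes z :: complex
  assumes "- X \<le> Re z" "Re z \<le> 0"
  shows "norm (rGamma z) \<le> (2 * X + 1) powr X * exp (pi * \<bar>Im z\<bar>)"
proof -
  have nz: "rGamma (1 - z) \<noteq> 0"
    using assms Re_nonpos_Ints[of "1 - z"] by (auto simp: rGamma_eq_zero_iff)
  have "rGamma z = sin (of_real pi * z) / of_real pi * Gamma (1 - z)"
    using rGamma_reflection_complex[of z] nz by (simp add: Gamma_def field_simps)
  hence "norm (rGamma z) = norm (sin (of_real pi * z)) * norm (Gamma (1 - z)) / pi"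
    by (simp add: norm_mult norm_divide)
  also have "\<dots> \<le> exp (pi * \<bar>Im z\<bar>) * (2 * (2 * X + 1) powr X) / 2"
    using cmod_sin_le_exp[of 1 "of_real pi * z"] norm_Gamma_le[of "1 - z" X] assms pi_ge_two
    by (intro mult_mono frac_le) (auto simp: abs_mult)
  finally show ?thesis by (simp add: mult_ac)
qed

text \<open>
In the strip \<open>0 \<le> Re z \<le> 2\<close> the function is bounded on the compact part \<open>\<bar>Im z\<bar> \<le> 1\<close>; off it,
two steps of \<open>\<Gamma> (z + 1) = z * \<Gamma> z\<close> lead into the left half-plane, dividing by factors of
modulus at least 1. The same division leads from any \<open>z\<close> with \<open>Re z > 2\<close> down to the strip.
\<close>
lemma norm_rGamma_le_right:
  "\<exists>C\<ge>0. \<forall>z::complex. 0 \<le> Re z \<longrightarrow> norm (rGamma z) \<le> C * exp (pi * \<bar>Im z\<bar>)"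
proof -
  have "continuous_on (cbox (Complex 0 (-1)) (Complex 2 1)) (\<lambda>z. rGamma z)"
    by (intro continuous_intros)
  then obtain C0 where C0: "\<And>z. z \<in> cbox (Complex 0 (-1)) (Complex 2 1) \<Longrightarrow> norm (rGamma z) \<le> C0"
    using continuous_on_compact_norm_bound[OF _ compact_cbox] by blast
  \<comment> \<open>\<open>25 = (2 * 2 + 1) powr 2\<close> is the bound in the left half-plane for \<open>X = 2\<close>.\<close>
  define C where "C = max C0 25"
  have strip: "norm (rGamma z) \<le> C * exp (pi * \<bar>Im z\<bar>)" if z: "0 \<le> Re z" "Re z \<le> 2" for z :: complex
  proof (cases "\<bar>Im z\<bar> \<le> 1")
    case True
    have "norm (rGamma z) \<le> C * 1"
      using C0[of z] True z by (auto simp: C_def in_cbox_complex_iff abs_le_iff)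
    also have "\<dots> \<le> C * exp (pi * \<bar>Im z\<bar>)" by (intro mult_left_mono) (auto simp: C_def)
    finally show ?thesis .
  next
    case False
    have z1: "norm (z - 2) \<ge> 1" "norm (z - 1) \<ge> 1"
      using False abs_Im_le_cmod[of "z - 2"] abs_Im_le_cmod[of "z - 1"] by auto
    have "rGamma (z - 2) = (z - 2) * ((z - 1) * rGamma z)"
      using rGamma_plus1[of "z - 2"] rGamma_plus1[of "z - 1"] by simp
    hence "norm (rGamma (z - 2)) = norm (z - 2) * norm (z - 1) * norm (rGamma z)"
      by (simp add: norm_mult)
    moreover have "norm (z - 2) * norm (z - 1) * norm (rGamma z) \<ge> 1 * norm (rGamma z)"
      using z1 mult_mono[of 1 "norm (z - 2)" 1 "norm (z - 1)"] by (intro mult_right_mono) auto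
    ultimately have "norm (rGamma z) \<le> norm (rGamma (z - 2))" by simp
    also have "\<dots> \<le> (2 * 2 + 1) powr 2 * exp (pi * \<bar>Im (z - 2)\<bar>)"
      by (rule norm_rGamma_le_left) (use z in auto)
    also have "\<dots> \<le> C * exp (pi * \<bar>Im z\<bar>)"
      by (simp add: C_def)
    finally show ?thesis .
  qed
  have "norm (rGamma z) \<le> C * exp (pi * \<bar>Im z\<bar>)" if "0 \<le> Re z" "Re z \<le> 2 + real n" for z :: complex and n
    using that
  proof (induction n arbitrary: z)
    case 0
    then show ?case using strip[of z] by simp
  next
    case (Suc n)
    show ?case
    proof (cases "Re z \<le> 2")
      case False
      have "norm (z - 1) \<ge> 1" using False abs_Re_le_cmod[of "z - 1"] by auto
      hence "1 * norm (rGamma z) \<le> norm (z - 1) * norm (rGamma z)" by (intro mult_right_mono) auto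
      also have "\<dots> = norm (rGamma (z - 1))"
        using rGamma_plus1[of "z - 1"] by (simp flip: norm_mult)
      also have "\<dots> \<le> C * exp (pi * \<bar>Im (z - 1)\<bar>)"
        by (rule Suc.IH) (use Suc.prems False in auto)
      finally show ?thesis by simp
    qed (use strip Suc.prems in auto)
  qed
  hence "norm (rGamma z) \<le> C * exp (pi * \<bar>Im z\<bar>)" if "0 \<le> Re z" for z :: complex
    using that real_arch_simple[of "Re z - 2"] by (metis add.commute diff_le_eq)
  moreover have "C \<ge> 0" by (simp add: C_def)
  ultimately show ?thesis by blast
qed

lemma norm_rGamma_le:
  "\<exists>C\<ge>0. \<forall>X\<ge>0. \<forall>z::complex. - X \<le> Re z \<longrightarrow>
     norm (rGamma z) \<le> C * ((2 * X + 1) powr X * exp (pi * \<bar>Im z\<bar>))"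
proof -
  obtain C where C: "C \<ge> 0" "\<And>z::complex. 0 \<le> Re z \<Longrightarrow> norm (rGamma z) \<le> C * exp (pi * \<bar>Im z\<bar>)"
    using norm_rGamma_le_right by blast
  have "norm (rGamma z) \<le> (C + 1) * ((2 * X + 1) powr X * exp (pi * \<bar>Im z\<bar>))"
    if X: "X \<ge> 0" "- X \<le> Re z" for X and z :: complex
  proof (cases "Re z \<le> 0")
    case True
    have "norm (rGamma z) \<le> 1 * ((2 * X + 1) powr X * exp (pi * \<bar>Im z\<bar>))"
      using norm_rGamma_le_left[of X z] True X by simp
    also have "\<dots> \<le> (C + 1) * ((2 * X + 1) powr X * exp (pi * \<bar>Im z\<bar>))"
      using C(1) by (intro mult_right_mono) auto
    finally show ?thesis .
  next
    case False
    have "norm (rGamma z) \<le> C * (1 * exp (pi * \<bar>Im z\<bar>))" using C(2)[of z] False by simp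
    also have "\<dots> \<le> (C + 1) * ((2 * X + 1) powr X * exp (pi * \<bar>Im z\<bar>))"
      using C(1) X by (intro mult_mono ge_one_powr_ge_zero) auto
    finally show ?thesis .
  qed
  thus ?thesis using C(1) by (intro exI[of _ "C + 1"]) auto
qed

text \<open>
Since \<open>Re \<alpha> > -1\<close>, there is \<open>a < 1\<close> with \<open>Re (\<alpha> * n + \<beta>) \<ge> - (a * n + b)\<close>. So the coefficient
\<open>1 / \<Gamma> (\<alpha> * n + \<beta>)\<close> grows at most like \<open>n powr (a * n)\<close> up to a factor exponential in \<open>n\<close>, and
\<open>fact n\<close>, which is at least \<open>(n / e) ^ n\<close>, wins for every \<open>z\<close>.
\<close>
lemma summable_wright:
  fixes \<alpha> \<beta> z :: complex
  assumes "Re \<alpha> > -1"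
  shows "summable (\<lambda>n. rGamma (\<alpha> * of_nat n + \<beta>) / fact n * z ^ n)"
proof -
  obtain C where C: "C \<ge> 0" "\<And>X z::complex. X \<ge> 0 \<Longrightarrow> - X \<le> Re z \<Longrightarrow>
     norm (rGamma z) \<le> C * ((2 * X + 1) powr X * exp (pi * \<bar>Im z\<bar>))"
    using norm_rGamma_le by blast
  obtain a where a: "0 < a" "a < 1" "- Re \<alpha> \<le> a"
    using assms dense[of "max 0 (- Re \<alpha>)" 1] by auto
  define b c d r where "b = \<bar>Re \<beta>\<bar>" and "c = pi * \<bar>Im \<alpha>\<bar>" and "d = pi * \<bar>Im \<beta>\<bar>" and "r = norm z + 1"
  have pos: "b \<ge> 0" "c \<ge> 0" "d \<ge> 0" "r > 0" by (auto simp: b_def c_def d_def r_def add_nonneg_pos)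
  define T where "T = (\<lambda>n::nat. (2 * (a * n + b) + 1) powr (a * n + b) * exp (c * n + d)
                          * r powr n * (exp (real n) / real n powr n))"
  have "eventually (\<lambda>n::nat. (a * n + b) * ln (2 * (a * n + b) + 1) + (c * n + d) + n * ln r + n - n * ln n
                               \<le> - (n * ln 2)) sequentially"
    using a(1,2) by real_asymp
  hence "eventually (\<lambda>n. T n \<le> (1 / 2) powr n) sequentially"
    using eventually_gt_at_top[of 0]
  proof eventually_elim
    case (elim n)
    have "2 * (a * n + b) + 1 > 0" using a pos by (intro add_nonneg_pos) auto
    hence "T n = exp ((a * n + b) * ln (2 * (a * n + b) + 1) + (c * n + d) + n * ln r + n - n * ln n)"
      using elim pos by (simp add: T_def powr_def exp_add exp_diff)
    also have "\<dots> \<le> exp (- (n * ln 2))" using elim(1) by (simp only: exp_le_cancel_iff)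
    finally show ?case by (simp add: powr_def ln_div)
  qed
  hence ev: "eventually (\<lambda>n. norm (rGamma (\<alpha> * of_nat n + \<beta>) / fact n * z ^ n) \<le> C * (1 / 2) ^ n) sequentially"
    using eventually_gt_at_top[of 0]
  proof eventually_elim
    case (elim n)
    define X where "X = a * n + b"
    have X: "X \<ge> 0" using a pos by (simp add: X_def)
    have "- Re \<alpha> * n \<le> a * n" using a by (intro mult_right_mono) auto
    hence "norm (rGamma (\<alpha> * of_nat n + \<beta>)) \<le> C * ((2 * X + 1) powr X * exp (pi * \<bar>Im (\<alpha> * of_nat n + \<beta>)\<bar>))"
      using X by (intro C) (auto simp: X_def b_def)
    also have "\<dots> \<le> C * ((2 * X + 1) powr X * exp (c * n + d))"
    proof -
      have "pi * \<bar>Im \<alpha> * n + Im \<beta>\<bar> \<le> pi * (\<bar>Im \<alpha>\<bar> * n + \<bar>Im \<beta>\<bar>)"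
        using abs_triangle_ineq[of "Im \<alpha> * n" "Im \<beta>"] by (intro mult_left_mono) (auto simp: abs_mult)
      thus ?thesis using C(1) by (intro mult_left_mono) (auto simp: c_def d_def algebra_simps)
    qed
    finally have 1: "norm (rGamma (\<alpha> * of_nat n + \<beta>)) \<le> C * ((2 * X + 1) powr X * exp (c * n + d))" .
    have "real n ^ n / fact n \<le> exp (real n)"
    proof -
      have "(\<Sum>k\<in>{n}. real n ^ k /\<^sub>R fact k) \<le> (\<Sum>k. real n ^ k /\<^sub>R fact k)"
        by (intro sum_le_suminf summable_exp_generic) auto
      thus ?thesis by (simp add: exp_def field_simps)
    qed
    hence 2: "1 / fact n \<le> exp (real n) / real n powr n"
      using elim by (simp add: field_simps powr_realpow)
    have 3: "norm z ^ n \<le> r powr n"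
      using pos by (simp add: powr_realpow r_def power_mono)
    have "norm (rGamma (\<alpha> * of_nat n + \<beta>) / fact n * z ^ n)
            = norm (rGamma (\<alpha> * of_nat n + \<beta>)) * (1 / fact n) * norm z ^ n"
      by (simp add: norm_mult norm_divide norm_power)
    also have "\<dots> \<le> C * ((2 * X + 1) powr X * exp (c * n + d)) * (exp (real n) / real n powr n) * r powr n"
      using C(1) by (intro mult_mono 1 2 3 mult_nonneg_nonneg) auto
    also have "\<dots> = C * T n" by (simp add: T_def X_def field_simps)
    also have "\<dots> \<le> C * (1 / 2) powr n" using elim C(1) by (intro mult_left_mono) auto
    finally show ?case by (simp add: powr_realpow)
  qed
  show ?thesis
    by (rule summable_comparison_test_ev[OF ev]) (intro summable_mult summable_geometric; simp)
qed

lemma isCont_wright: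
  assumes "Re \<alpha> > -1"
  shows "isCont (wright \<alpha> \<beta>) z"
proof -
  have "isCont (\<lambda>z. \<Sum>n. rGamma (\<alpha> * of_nat n + \<beta>) / fact n * z ^ n) z"
    by (rule isCont_powser_converges_everywhere) (rule summable_wright[OF assms])
  thus ?thesis by (simp add: wright_def[abs_def])
qed

lemma continuous_on_wright [continuous_intros]:
  assumes "Re \<alpha> > -1" "continuous_on S f"
  shows "continuous_on S (\<lambda>t. wright \<alpha> \<beta> (f t))"
  using isCont_wright[OF assms(1)] assms(2)
  by (intro continuous_on_compose2[OF _ assms(2), of UNIV]) (auto simp: continuous_on_eq_continuous_at)

section \<open>Improper integrals at 0 and infinity\<close>

text \<open>
Hake's theorem for an integrand that is continuous away from 0. The assumed limit is what makes
the primitive \<open>a \<mapsto> - integral {a..c} f\<close> continuous up to 0, and the fundamental theorem needs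
derivatives only in the open interval.
\<close>
lemma has_integral_0_limit:
  fixes f :: "real \<Rightarrow> 'a::banach"
  assumes c: "c > 0" and cont: "continuous_on {0<..c} f"
    and lim: "((\<lambda>a. integral {a..c} f) \<longlongrightarrow> L) (at_right 0)"
  shows "(f has_integral L) {0..c}"
proof -
  define \<Phi> where "\<Phi> = (\<lambda>a. if a = 0 then - L else - integral {a..c} f)"
  have cont': "continuous_on {a..c} f" if "a > 0" for a
    using cont by (rule continuous_on_subset) (use that in auto)
  have deriv: "(\<Phi> has_vector_derivative f a) (at a)" if a: "a \<in> {0<..<c}" for a
  proof -
    have "((\<lambda>u. integral {a / 2..u} f) has_vector_derivative f a) (at a within {a / 2..c})"
      by (rule integral_has_vector_derivative[OF cont']) (use a in auto)
    hence "((\<lambda>u. integral {a / 2..u} f) has_vector_derivative f a) (at a)"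
      using a by (subst (asm) at_within_interior) auto
    hence "((\<lambda>u. integral {a / 2..u} f - integral {a / 2..c} f) has_vector_derivative f a) (at a)"
      by (auto intro!: derivative_eq_intros)
    thus ?thesis
    proof (rule has_vector_derivative_transform_within_open)
      fix u assume u: "u \<in> {a / 2<..<c}"
      have "integral {a / 2..u} f + integral {u..c} f = integral {a / 2..c} f"
        using u a by (intro Henstock_Kurzweil_Integration.integral_combine integrable_continuous_interval cont') auto
      thus "integral {a / 2..u} f - integral {a / 2..c} f = \<Phi> u"
        using u a by (auto simp: \<Phi>_def algebra_simps)
    qed (use a in auto)
  qed
  have "continuous_on {0..c} \<Phi>"
    unfolding continuous_on_eq_continuous_within
  proof
    fix a assume a: "a \<in> {0..c}"
    consider "a = 0" | "a \<in> {0<..<c}" | "a = c" using a by force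
    thus "continuous (at a within {0..c}) \<Phi>"
    proof cases
      case 1
      have "((\<lambda>a. - integral {a..c} f) \<longlongrightarrow> - L) (at_right 0)" by (intro tendsto_intros lim)
      hence "(\<Phi> \<longlongrightarrow> - L) (at_right 0)"
        by (rule Lim_transform_eventually) (auto simp: \<Phi>_def eventually_at_filter)
      hence "(\<Phi> \<longlongrightarrow> - L) (at 0 within {0..c})"
        using c by (simp add: at_within_Icc_at_right)
      thus ?thesis using 1 by (simp add: continuous_within \<Phi>_def)
    next
      case 2
      thus ?thesis using deriv has_vector_derivative_continuous continuous_at_imp_continuous_within by blast
    next
      case 3
      have "continuous_on {c / 2..c} (\<lambda>u. - integral {u..c} f)"
        using c by (intro continuous_on_minus indefinite_integral_continuous_1' integrable_continuous_interval cont') auto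
      hence "((\<lambda>u. - integral {u..c} f) \<longlongrightarrow> - integral {c..c} f) (at c within {c / 2..c})"
        unfolding continuous_on_def using c by (intro bspec[of _ _ c]) auto
      hence "((\<lambda>u. - integral {u..c} f) \<longlongrightarrow> \<Phi> c) (at_left c)"
        using c by (simp add: at_within_Icc_at_left \<Phi>_def)
      moreover have "eventually (\<lambda>u. - integral {u..c} f = \<Phi> u) (at_left c)"
        using eventually_at_left_real[OF c] by eventually_elim (auto simp: \<Phi>_def)
      ultimately have "(\<Phi> \<longlongrightarrow> \<Phi> c) (at_left c)" by (rule Lim_transform_eventually)
      thus ?thesis using 3 c by (simp add: continuous_within at_within_Icc_at_left)
    qed
  qed
  from fundamental_theorem_of_calculus_interior[OF _ this deriv] c
  have "(f has_integral (\<Phi> c - \<Phi> 0)) {0..c}" by auto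
  thus ?thesis using c by (simp add: \<Phi>_def)
qed

text \<open>
Cauchy's criterion at 0 in quantitative form. That \<open>K\<close> bounds the whole tail as well
is what later gives uniformity in a parameter.
\<close>
lemma integrable_0_tail_bound:
  fixes f :: "real \<Rightarrow> 'a::banach"
  assumes b0: "0 < b0" "b0 \<le> c" and cont: "continuous_on {0<..c} f" and \<sigma>: "\<sigma> > 0"
    and tail: "\<And>a b. 0 < a \<Longrightarrow> a \<le> b \<Longrightarrow> b \<le> b0 \<Longrightarrow> norm (integral {a..b} f) \<le> K * b powr \<sigma>"
  shows "f integrable_on {0..c}"
    and "0 < b \<Longrightarrow> b \<le> b0 \<Longrightarrow> norm (integral {0..c} f - integral {b..c} f) \<le> K * b powr \<sigma>"
proof -
  define I where "I = (\<lambda>a. integral {a..c} f)"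
  have diff: "norm (I a - I b) \<le> K * b powr \<sigma>" if "0 < a" "a \<le> b" "b \<le> b0" for a b
  proof -
    have "integral {a..b} f + integral {b..c} f = integral {a..c} f"
      using that b0
      by (intro Henstock_Kurzweil_Integration.integral_combine integrable_continuous_interval
            continuous_on_subset[OF cont]) auto
    hence "I a - I b = integral {a..b} f" unfolding I_def by (metis add_diff_cancel_right')
    thus ?thesis using tail[OF that] by simp
  qed
  define s where "s = (\<lambda>n::nat. b0 / real (Suc n))"
  have s: "0 < s n" "s n \<le> b0" for n using b0 by (auto simp: s_def divide_le_eq mult_le_cancel_left1)
  have s_mono: "s n \<le> s m" if "m \<le> n" for m n
    unfolding s_def using that b0 by (intro divide_left_mono) auto
  have s_lim: "s \<longlonglongrightarrow> 0" unfolding s_def using LIMSEQ_Suc[OF lim_const_over_n[of b0]] by simp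
  have "(\<lambda>n. s n powr \<sigma>) \<longlonglongrightarrow> 0" 
    using tendsto_powr'[OF s_lim tendsto_const[of \<sigma>]] \<sigma> less_imp_le[OF s(1)] by simp
  hence K_lim: "(\<lambda>n. K * s n powr \<sigma>) \<longlonglongrightarrow> 0" by (rule tendsto_mult_right_zero)
  have "Cauchy (\<lambda>n. I (s n))"
  proof (rule CauchyI')
    fix e :: real assume "e > 0"
    with K_lim have "eventually (\<lambda>n. K * s n powr \<sigma> < e) sequentially"
      by (auto dest: order_tendstoD)
    then obtain N where N: "\<And>n. n \<ge> N \<Longrightarrow> K * s n powr \<sigma> < e" by (auto simp: eventually_sequentially)
    have "dist (I (s m)) (I (s n)) < e" if "m \<ge> N" "n > m" for m n
      using diff[of "s n" "s m"] s[of m] s[of n] s_mono[of m n] N[of m] that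
      by (auto simp: dist_norm norm_minus_commute)
    thus "\<exists>M. \<forall>m\<ge>M. \<forall>n>m. dist (I (s m)) (I (s n)) < e" by blast
  qed
  then obtain L where L: "(\<lambda>n. I (s n)) \<longlonglongrightarrow> L" using Cauchy_convergent convergentD by blast
  have dL: "norm (L - I b) \<le> K * b powr \<sigma>" if b: "0 < b" "b \<le> b0" for b
  proof (rule tendsto_upperbound)
    show "(\<lambda>n. norm (I (s n) - I b)) \<longlonglongrightarrow> norm (L - I b)" by (intro tendsto_intros L)
    have "eventually (\<lambda>n. s n < b) sequentially" using order_tendstoD(2)[OF s_lim] b by auto
    thus "eventually (\<lambda>n. norm (I (s n) - I b) \<le> K * b powr \<sigma>) sequentially"
      by eventually_elim (rule diff[OF s(1) less_imp_le b(2)])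
  qed simp
  have "((\<lambda>b. K * b powr \<sigma>) \<longlongrightarrow> K * 0 powr \<sigma>) (at_right 0)"
    using \<sigma> by (intro tendsto_mult tendsto_const tendsto_powr' tendsto_ident_at) (auto simp: eventually_at_filter)
  hence "((\<lambda>b. K * b powr \<sigma>) \<longlongrightarrow> 0) (at_right 0)" using \<sigma> by simp
  moreover have "eventually (\<lambda>b. norm (I b - L) \<le> K * b powr \<sigma>) (at_right 0)"
    using eventually_at_right_real[OF b0(1)] 
    by eventually_elim (simp add: norm_minus_commute dL)
  ultimately have "((\<lambda>b. I b - L) \<longlongrightarrow> 0) (at_right 0)"
    by (rule Lim_null_comparison[rotated])
  hence "(I \<longlongrightarrow> L) (at_right 0)" by (simp add: LIM_zero_iff)
  from has_integral_0_limit[OF _ cont this[unfolded I_def]] b0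
  have "(f has_integral L) {0..c}" by auto
  thus "f integrable_on {0..c}" "0 < b \<Longrightarrow> b \<le> b0 \<Longrightarrow> norm (integral {0..c} f - integral {b..c} f) \<le> K * b powr \<sigma>"
    using dL[of b] by (auto simp: integrable_on_def I_def integral_unique)
qed

lemma norm_integral_le_powr:
  fixes f :: "real \<Rightarrow> 'a::euclidean_space"
  assumes a: "0 < a" "a \<le> b" and cont: "continuous_on {a..b} f" and \<sigma>: "\<sigma> > 0"
    and bound: "\<And>t. a \<le> t \<Longrightarrow> t \<le> b \<Longrightarrow> norm (f t) \<le> C * t powr (\<sigma> - 1)"
  shows "norm (integral {a..b} f) \<le> C / \<sigma> * b powr \<sigma>"
proof -
  have "C * a powr (\<sigma> - 1) \<ge> 0" using bound[of a] a norm_ge_zero[of "f a"] by linarith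
  hence C: "C \<ge> 0" using a by (simp add: zero_le_mult_iff)
  have int: "((\<lambda>t. t powr (\<sigma> - 1)) has_integral (b powr (\<sigma> - 1 + 1) / (\<sigma> - 1 + 1))) {0..b}"
    by (rule has_integral_powr_from_0) (use \<sigma> a in auto)
  have "norm (integral {a..b} f) \<le> integral {a..b} (\<lambda>t. C * t powr (\<sigma> - 1))"
    using a bound by (intro integral_norm_bound_integral integrable_continuous_interval cont continuous_intros) auto
  also have "\<dots> = C * integral {a..b} (\<lambda>t. t powr (\<sigma> - 1))" by simp
  also have "integral {a..b} (\<lambda>t. t powr (\<sigma> - 1)) \<le> integral {0..b} (\<lambda>t. t powr (\<sigma> - 1))"
    using a by (intro integral_subset_le integrable_continuous_interval has_integral_integrable[OF int]
                  continuous_intros) auto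
  also have "\<dots> = b powr \<sigma> / \<sigma>" using int by (simp add: integral_unique)
  finally show ?thesis using C by (simp add: mult_left_mono)
qed

lemma integrable_0_powr_bound:
  fixes f :: "real \<Rightarrow> 'a::euclidean_space"
  assumes c: "c > 0" and cont: "continuous_on {0<..c} f" and \<sigma>: "\<sigma> > 0"
    and bound: "\<And>t. 0 < t \<Longrightarrow> t \<le> c \<Longrightarrow> norm (f t) \<le> C * t powr (\<sigma> - 1)"
  shows "f integrable_on {0..c}"
    and "0 < b \<Longrightarrow> b \<le> c \<Longrightarrow> norm (integral {0..c} f - integral {b..c} f) \<le> C / \<sigma> * b powr \<sigma>"
proof -
  have tail: "norm (integral {a..b} f) \<le> C / \<sigma> * b powr \<sigma>" if "0 < a" "a \<le> b" "b \<le> c" for a b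
    by (rule norm_integral_le_powr) (use that \<sigma> bound in \<open>auto intro: continuous_on_subset[OF cont]\<close>)
  show "f integrable_on {0..c}"
    and "0 < b \<Longrightarrow> b \<le> c \<Longrightarrow> norm (integral {0..c} f - integral {b..c} f) \<le> C / \<sigma> * b powr \<sigma>"
    using integrable_0_tail_bound[OF c order_refl cont \<sigma> tail] by blast+
qed

text \<open>
Fundamental theorem of calculus on the half-line, for an integral that may converge
only conditionally at both ends.
\<close>
lemma has_integral_0_infinity:
  fixes F :: "real \<Rightarrow> 'a::banach"
  assumes cont: "continuous_on {0..} F"
    and deriv: "\<And>p. p > 0 \<Longrightarrow> (F has_vector_derivative f p) (at p)"
    and lim: "(F \<longlongrightarrow> L) at_top"
  shows "(f has_integral (L - F 0)) {0<..}"
proof -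
  let ?f = "\<lambda>x. if x \<in> {0<..} then f x else 0"
  have I0: "(f has_integral (F b - F 0)) {0..b}" if "b \<ge> 0" for b
    using that by (intro fundamental_theorem_of_calculus_interior deriv continuous_on_subset[OF cont]) auto
  have I: "(?f has_integral (F (max 0 b) - F 0)) {a..b}" if "a \<le> 0" for a b
  proof (cases "b \<ge> 0")
    case True
    have "(?f has_integral (F b - F 0)) {0..b}"
      by (rule has_integral_spike[of "{0}", OF _ _ I0[OF True]]) auto
    moreover have "(?f has_integral 0) {a..0}"
      by (rule has_integral_is_0) auto
    ultimately have "(?f has_integral (0 + (F b - F 0))) {a..b}"
      using that True by (intro has_integral_combine[of a 0 b]) auto
    thus ?thesis using True by simp
  next
    case False
    thus ?thesis by (auto intro!: has_integral_is_0)
  qed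
  show ?thesis unfolding has_integral_alt'
  proof (intro conjI allI impI)
    fix a b :: real
    have "?f integrable_on {min a 0..b}" using I[of "min a 0" b] by (auto simp: integrable_on_def)
    thus "?f integrable_on cbox a b" by (rule integrable_on_subcbox) auto
  next
    fix e :: real assume "e > 0"
    with lim obtain B where B: "\<And>x. x \<ge> B \<Longrightarrow> dist (F x) L < e"
      unfolding tendsto_iff eventually_at_top_linorder by blast
    show "\<exists>B>0. \<forall>a b. ball 0 B \<subseteq> cbox a b \<longrightarrow> norm (integral (cbox a b) ?f - (L - F 0)) < e"
    proof (intro exI[of _ "max 1 B"] conjI allI impI)
      fix a b :: real assume sub: "ball 0 (max 1 B) \<subseteq> cbox a b"
      have "{- max 1 B<..<max 1 B} \<subseteq> {a..b}" using sub by (auto simp: dist_real_def subset_iff abs_less_iff)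
      hence ab: "a \<le> - max 1 B" "max 1 B \<le> b"
        by (auto simp: greaterThanLessThan_subseteq_atLeastAtMost_iff)
      have "a \<le> 0" "max 0 b = b" using ab by auto
      hence "integral {a..b} ?f = F b - F 0" using I[of a b] by (simp add: integral_unique)
      thus "norm (integral (cbox a b) ?f - (L - F 0)) < e"
        using B[of b] ab by (simp add: dist_norm)
    qed simp
  qed
qed

section \<open>The Beta integral with complex parameters\<close>

text \<open>
The indicator restricts to a set on which complex powers are continuous; beyond it lies the
branch cut of the logarithm.
\<close>
lemma borel_measurable_Gamma_kernel [measurable]:
  "(\<lambda>t. indicator {0<..} t *\<^sub>R (of_real t powr z / of_real (exp t)) :: complex) \<in> borel_measurable borel"
  by (intro borel_measurable_continuous_on_indicator continuous_intros) auto

lemma borel_measurable_Beta_kernel [measurable]: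
  "(\<lambda>t. indicator {0<..<1} t *\<^sub>R (of_real t powr z * (1 - of_real t) powr w) :: complex) \<in> borel_measurable borel"
  by (intro borel_measurable_continuous_on_indicator continuous_intros) (auto simp: complex_nonpos_Reals_iff)

lemma integrable_Gamma_kernel:
  assumes "Re z > 0"
  defines "g \<equiv> (\<lambda>t. indicator {0<..} t *\<^sub>R (of_real t powr (z - 1) / of_real (exp t)) :: complex)"
  shows "integrable lborel g" "integral\<^sup>L lborel g = Gamma z"
proof -
  have "(\<lambda>t. of_real t powr (z - 1) / of_real (exp t) :: complex) absolutely_integrable_on {0<..}"
    by (rule absolutely_integrable_Gamma_integral') fact
  hence 1: "set_integrable lborel {0<..} (\<lambda>t. of_real t powr (z - 1) / of_real (exp t) :: complex)"
    unfolding set_integrable_def by (subst (asm) integrable_completion) auto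
  thus "integrable lborel g" by (simp add: set_integrable_def g_def)
  have "integral\<^sup>L lborel g = integral {0<..} (\<lambda>t. of_real t powr (z - 1) / of_real (exp t))"
    using set_borel_integral_eq_integral(2)[OF 1] by (simp add: set_lebesgue_integral_def g_def)
  also have "\<dots> = Gamma z" using Gamma_integral_complex'[OF assms(1)] by (rule integral_unique)
  finally show "integral\<^sup>L lborel g = Gamma z" .
qed

lemma integrable_Beta_complex:
  assumes "Re a > 0" "Re b > 0"
  shows "set_integrable lborel {0<..<1} (\<lambda>t. of_real t powr (a - 1) * (1 - of_real t) powr (b - 1) :: complex)"
  unfolding set_integrable_def
proof (rule Bochner_Integration.integrable_bound)
  show "integrable lborel (\<lambda>t. indicator {0<..<1} t *\<^sub>R (t powr (Re a - 1) * (1 - t) powr (Re b - 1)))"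
    using set_integrable_subset[OF integrable_Beta[of "Re a" "Re b"], of "{0<..<1}"] assms
    by (simp add: set_integrable_def subset_iff)
  have "norm (indicator {0<..<1} t *\<^sub>R (of_real t powr (a - 1) * (1 - of_real t) powr (b - 1)) :: complex)
           \<le> norm (indicator {0<..<1} t *\<^sub>R (t powr (Re a - 1) * (1 - t) powr (Re b - 1)))" for t :: real
    using norm_of_real_powr[of t "a - 1"] norm_of_real_powr[of "1 - t" "b - 1"]
    by (auto simp: indicator_def norm_mult)
  thus "AE t in lborel. norm (indicator {0<..<1} t *\<^sub>R (of_real t powr (a - 1) * (1 - of_real t) powr (b - 1)) :: complex)
           \<le> norm (indicator {0<..<1} t *\<^sub>R (t powr (Re a - 1) * (1 - t) powr (Re b - 1)))" by simp
qed measurable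

text \<open>
The product \<open>\<Gamma> a * \<Gamma> b\<close> is the total mass of the convolution of the two integrands of Euler's
Gamma integral. Rescaling that convolution at \<open>u\<close> to the unit interval gives
\<open>u powr (a + b - 1) * exp (- u)\<close> times the integral wanted here. Fubini's theorem applies because
for positive real parts everything converges absolutely.
\<close>
theorem has_integral_Beta_complex:
  assumes a: "Re a > 0" and b: "Re b > 0"
  shows "((\<lambda>t. of_real t powr (a - 1) * (1 - of_real t) powr (b - 1)) has_integral Beta a b) {0<..<1}"
proof -
  define f g where "f = (\<lambda>t. indicator {0<..} t *\<^sub>R (of_real t powr (a - 1) / of_real (exp t)) :: complex)"
    and "g = (\<lambda>t. indicator {0<..} t *\<^sub>R (of_real t powr (b - 1) / of_real (exp t)) :: complex)"
  define k where "k = (\<lambda>t::real. indicator {0<..<1} t *\<^sub>R (of_real t powr (a - 1) * (1 - of_real t) powr (b - 1)) :: complex)"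
  have [measurable]: "f \<in> borel_measurable borel" "g \<in> borel_measurable borel" unfolding f_def g_def by measurable
  have f: "integrable lborel f" "integral\<^sup>L lborel f = Gamma a"
    using integrable_Gamma_kernel[OF a] by (simp_all add: f_def)
  have g: "integrable lborel g" "integral\<^sup>L lborel g = Gamma b"
    using integrable_Gamma_kernel[OF b] by (simp_all add: g_def)
  have shift: "integrable lborel (\<lambda>u. g (u - t))" "integral\<^sup>L lborel (\<lambda>u. g (u - t)) = Gamma b" for t
    using lborel_integrable_real_affine[OF g(1), of 1 "-t"] lborel_integral_real_affine[of 1 g "-t"] g(2) by simp_all
  have int: "integrable (lborel \<Otimes>\<^sub>M lborel) (\<lambda>(t, u). f t * g (u - t))"
  proof (rule lborel_pair.Fubini_integrable)
    have "(\<integral>u. norm (f t * g (u - t)) \<partial>lborel) = norm (f t) * (\<integral>u. norm (g u) \<partial>lborel)" for t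
      using lborel_integral_real_affine[of 1 "\<lambda>u. norm (g u)" "-t"] by (simp add: norm_mult)
    thus "integrable lborel (\<lambda>x. \<integral>y. norm (case (x, y) of (t, u) \<Rightarrow> f t * g (u - t)) \<partial>lborel)"
      using f(1) by simp
  qed (use shift in auto)
  have "Gamma a * Gamma b = (\<integral>t. (\<integral>u. f t * g (u - t) \<partial>lborel) \<partial>lborel)"
    using shift f by simp
  also have "\<dots> = (\<integral>u. (\<integral>t. f t * g (u - t) \<partial>lborel) \<partial>lborel)"
    by (rule lborel_pair.Fubini_integral[symmetric]) (use int in simp)
  also have "\<dots> = (\<integral>u. integral\<^sup>L lborel k * (indicator {0<..} u *\<^sub>R (of_real u powr (a + b - 1) / of_real (exp u))) \<partial>lborel)"
  proof (rule Bochner_Integration.integral_cong)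
    fix u :: real
    show "(\<integral>t. f t * g (u - t) \<partial>lborel) = integral\<^sup>L lborel k * (indicator {0<..} u *\<^sub>R (of_real u powr (a + b - 1) / of_real (exp u)))"
    proof (cases "u > 0")
      case False
      hence "(\<lambda>t. f t * g (u - t)) = (\<lambda>_. 0)" by (auto simp: f_def g_def indicator_def)
      thus ?thesis using False by simp
    next
      case True
      have "(\<integral>t. f t * g (u - t) \<partial>lborel) = u *\<^sub>R (\<integral>t. f (u * t) * g (u - u * t) \<partial>lborel)"
        using lborel_integral_real_affine[of u "\<lambda>t. f t * g (u - t)" 0] True by simp
      \<comment> \<open>The two kernels vanish outside the positive axis, which leaves just \<open>t\<close> in the unit interval.\<close>
      also have "(\<lambda>t. f (u * t) * g (u - u * t)) = (\<lambda>t. of_real u powr (a + b - 2) / of_real (exp u) * k t)"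
      proof
        fix t :: real
        consider "t \<le> 0" | "t \<ge> 1" | "0 < t" "t < 1" by linarith
        thus "f (u * t) * g (u - u * t) = of_real u powr (a + b - 2) / of_real (exp u) * k t"
        proof cases
          case 3
          have "complex_of_real (u * t) powr (a - 1) = of_real u powr (a - 1) * of_real t powr (a - 1)"
            using True 3 by (simp add: powr_times_real)
          moreover have "complex_of_real (u * (1 - t)) powr (b - 1) = of_real u powr (b - 1) * (1 - of_real t) powr (b - 1)"
            using True 3 powr_times_real[of "of_real u" "1 - of_real t" "b - 1"] by simp
          moreover have "complex_of_real u powr (a + b - 2) = of_real u powr (a - 1) * of_real u powr (b - 1)"
            by (simp flip: powr_add)
          moreover have "exp u = exp (u * t) * exp (u * (1 - t))" 
            by (simp flip: exp_add add: algebra_simps)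
          moreover have "u - u * t = u * (1 - t)" by (simp add: algebra_simps)
          ultimately show ?thesis using True 3
            by (simp add: f_def g_def k_def indicator_def mult_ac)
        next
          case 1
          hence "u * t \<le> 0" using True by (simp add: mult_le_0_iff)
          thus ?thesis using 1 by (auto simp: f_def k_def indicator_def)
        next
          case 2
          hence "u - u * t \<le> 0" using True by simp
          thus ?thesis using 2 by (auto simp: g_def k_def indicator_def)
        qed
      qed
      also have "u *\<^sub>R (\<integral>t. of_real u powr (a + b - 2) / of_real (exp u) * k t \<partial>lborel)
                   = (of_real u * of_real u powr (a + b - 2)) / of_real (exp u) * integral\<^sup>L lborel k"
        by (simp add: scaleR_conv_of_real)
      also have "of_real u * complex_of_real u powr (a + b - 2) = of_real u powr (a + b - 1)"
        using True powr_add[of "complex_of_real u" 1 "a + b - 2"] by simp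
      finally show ?thesis using True by simp
    qed
  qed auto
  also have "\<dots> = integral\<^sup>L lborel k * Gamma (a + b)"
    using integrable_Gamma_kernel(2)[of "a + b"] a b by (simp only: integral_mult_right_zero plus_complex.sel)
  finally have "integral\<^sup>L lborel k * Gamma (a + b) = Gamma a * Gamma b" by simp
  moreover have "Gamma (a + b) \<noteq> 0"
    using a b Re_nonpos_Ints[of "a + b"] by (auto simp: Gamma_eq_zero_iff)
  ultimately have "integral\<^sup>L lborel k = Beta a b" by (simp add: Beta_def field_simps)
  moreover have "((\<lambda>t. of_real t powr (a - 1) * (1 - of_real t) powr (b - 1)) has_integral integral\<^sup>L lborel k) {0<..<1}"
    using set_borel_integral_eq_integral[OF integrable_Beta_complex[OF a b]]
    by (simp add: set_lebesgue_integral_def k_def has_integral_iff)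
  ultimately show ?thesis by simp
qed

section \<open>The Mellin transform on half of the unit interval\<close>

text \<open>
All that the argument uses of the Wright function on the negative axis is continuity and a
Mellin transform \<open>\<Psi>\<close> at \<open>s\<close>, possibly only conditionally convergent.
\<close>
locale mellin_kernel =
  fixes W :: "real \<Rightarrow> complex" and s \<Psi> :: complex
  assumes cont_W: "continuous_on {0<..} W"
    and has_integral_\<Psi>: "((\<lambda>v. of_real v powr (s - 1) * W v) has_integral \<Psi>) {0<..}"
begin

definition g :: "real \<Rightarrow> complex" where "g v = of_real v powr (s - 1) * W v"

text \<open>
The truncated Mellin integral. It is bounded and tends to \<open>\<Psi>\<close>, so it can be used under
dominated convergence, which its possibly not absolutely integrable derivative \<open>g\<close> cannot.
\<close>
definition G :: "real \<Rightarrow> complex" where "G v = integral {0..v} g"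

lemma cont_g: "continuous_on {0<..} g"
  unfolding g_def by (intro continuous_intros cont_W) auto

lemma G_0: "G 0 = 0"
  by (simp add: G_def)

lemma integrable_g: "g integrable_on {0..b}"
proof -
  have "g integrable_on {0<..}"
    using has_integral_\<Psi> by (auto simp: integrable_on_def g_def[abs_def])
  hence "g integrable_on {0..}"
    by (rule integrable_spike_set) (auto intro: negligible_subset[of "{0}"])
  thus ?thesis by (rule integrable_on_subinterval) auto
qed

lemma continuous_on_G: "continuous_on {0..} G"
  unfolding continuous_on_eq_continuous_within
proof
  fix v :: real assume v: "v \<in> {0..}"
  have "continuous_on {0..v + 1} G"
    unfolding G_def by (rule indefinite_integral_continuous_1[OF integrable_g])
  hence "continuous (at v within {0..v + 1}) G"
    using v by (auto simp: continuous_on_eq_continuous_within)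
  moreover have "at v within {0..v + 1} = at v within {0..}"
    by (rule at_within_nhd[of _ "{..<v + 1}"]) auto
  ultimately show "continuous (at v within {0..}) G" by simp
qed

lemma G_has_vector_derivative:
  assumes "v > 0"
  shows "(G has_vector_derivative g v) (at v)"
proof -
  have "continuous (at v within {0..v + 1}) g"
    using cont_g assms by (auto intro: continuous_at_imp_continuous_within simp: continuous_on_eq_continuous_at)
  hence "(G has_vector_derivative g v) (at v within {0..v + 1})"
    unfolding G_def using assms by (intro integral_has_vector_derivative_continuous_at[where S = "{}", simplified] integrable_g) auto
  thus ?thesis using assms by (subst (asm) at_within_interior) auto
qed

lemma G_tendsto: "(G \<longlongrightarrow> \<Psi>) at_top"
  unfolding tendsto_iff
proof (intro allI impI)
  fix e :: real assume "e > 0"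
  let ?g = "\<lambda>x. if x \<in> {0<..} then g x else 0"
  have "(g has_integral \<Psi>) {0<..}" using has_integral_\<Psi> by (simp add: g_def[abs_def])
  with \<open>e > 0\<close> obtain B where B: "B > 0"
      "\<And>a b. ball 0 B \<subseteq> cbox a b \<Longrightarrow> norm (integral (cbox a b) ?g - \<Psi>) < e"
    unfolding has_integral_alt' by meson
  have "dist (G v) \<Psi> < e" if v: "v \<ge> B" for v
  proof -
    have "(?g has_integral G v) {0..v}"
      unfolding G_def
      by (rule has_integral_spike[of "{0}", OF _ _ integrable_integral[OF integrable_g]]) auto
    moreover have "(?g has_integral 0) {- v..0}" by (rule has_integral_is_0) auto
    ultimately have "(?g has_integral (0 + G v)) {-v..v}"
      using v B(1) by (intro has_integral_combine[of "-v" 0 v]) auto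
    hence "integral {-v..v} ?g = G v" by (simp add: integral_unique)
    moreover have "ball 0 B \<subseteq> cbox (-v) v" using v by (auto simp: dist_real_def abs_less_iff)
    ultimately show ?thesis using B(2)[of "-v" v] by (simp add: dist_norm)
  qed
  thus "eventually (\<lambda>v. dist (G v) \<Psi> < e) at_top" by (auto simp: eventually_at_top_linorder)
qed

lemma G_bounded: obtains M where "M > 0" "\<And>v. v \<ge> 0 \<Longrightarrow> norm (G v) \<le> M"
proof -
  from G_tendsto have "eventually (\<lambda>v. dist (G v) \<Psi> < 1) at_top" by (rule tendstoD) simp
  then obtain B where B: "\<And>v. v \<ge> B \<Longrightarrow> dist (G v) \<Psi> < 1" by (auto simp: eventually_at_top_linorder)
  obtain M where M: "M > 0" "\<And>v. v \<in> {0..B} \<Longrightarrow> norm (G v) \<le> M"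
    by (rule continuous_on_compact_norm_bound[OF continuous_on_subset[OF continuous_on_G] compact_Icc, of 0 B]) auto
  have "norm (G v) \<le> M + norm \<Psi> + 1" if "v \<ge> 0" for v
  proof (cases "v \<le> B")
    case True
    hence "norm (G v) \<le> M" using M(2) that by simp
    thus ?thesis using norm_ge_zero[of \<Psi>] by linarith
  next
    case False
    hence "norm (G v - \<Psi>) < 1" using B[of v] by (simp add: dist_norm)
    moreover have "norm (G v) \<le> norm (G v - \<Psi>) + norm \<Psi>"
      using norm_triangle_ineq[of "G v - \<Psi>" \<Psi>] by simp
    ultimately show ?thesis using M(1) by linarith
  qed
  thus thesis using that[of "M + norm \<Psi> + 1"] M(1) norm_ge_zero[of \<Psi>] by fastforce
qed

text \<open>
The interval \<open>{0<..<1}\<close> is cut at \<open>1/2\<close>, where \<open>t \<mapsto> t * (1 - t)\<close> stops being monotone. On the left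
half the singularity is at \<open>t = 0\<close>, where convergence depends on \<open>x\<close>; the right half is
the reflection of the left one with \<open>x\<close> and \<open>y\<close> exchanged.
\<close>

context
  fixes x y :: complex
  assumes x: "Re (x + s) > 0"
begin

definition k :: "real \<Rightarrow> complex" where
  "k t = of_real t powr (x + s - 1) * (1 - of_real t) powr (y + s - 1)"

text \<open>
The function \<open>\<phi> p\<close> is \<open>p powr (s - 1)\<close> times the integrand of the \<open>\<Psi>\<close>-beta function at \<open>p\<close>
with \<open>W\<close> in place of the Wright function (see \<open>\<phi>_eq\<close>), and \<open>\<phi> p t\<close> is also the derivative of
\<open>k t * G (p / (t * (1 - t)))\<close> with respect to \<open>p\<close>.
\<close>
definition \<phi> :: "real \<Rightarrow> real \<Rightarrow> complex" where
  "\<phi> p t = k t * g (p / (t * (1 - t))) / of_real (t * (1 - t))"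

lemma k_0: "k 0 = 0" by (simp add: k_def)

lemma cont_k: "continuous_on {0<..1/2} k"
  unfolding k_def by (intro continuous_intros) (auto simp: complex_nonpos_Reals_iff)

lemma w_pos: "0 < t \<Longrightarrow> t \<le> 1 / 2 \<Longrightarrow> 0 < t * (1 - t :: real)"
  by (intro mult_pos_pos) auto

lemma w_nonneg: "0 \<le> t \<Longrightarrow> t \<le> 1 / 2 \<Longrightarrow> 0 \<le> t * (1 - t :: real)"
  by (intro mult_nonneg_nonneg) auto

lemma cont_\<phi>: "continuous_on ({0<..} \<times> {0<..1/2}) (\<lambda>(p, t). \<phi> p t)"
proof -
  have "continuous_on ({0<..} \<times> {0<..1/2}) (\<lambda>z. k (snd z))"
    by (rule continuous_on_compose2[OF cont_k]) (auto intro!: continuous_intros)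
  moreover have "continuous_on ({0<..} \<times> {0<..1/2}) (\<lambda>z. g (fst z / (snd z * (1 - snd z))))"
    by (rule continuous_on_compose2[OF cont_g]) (auto intro!: continuous_intros divide_pos_pos w_pos)
  ultimately show ?thesis
    unfolding \<phi>_def case_prod_unfold by (intro continuous_intros) auto
qed

lemma cont_\<phi>':
  assumes "p > 0"
  shows "continuous_on {0<..1/2} (\<phi> p)"
proof -
  have "continuous_on {0<..1/2} (\<lambda>t. (p, t))" by (intro continuous_intros)
  from continuous_on_compose2[OF cont_\<phi> this] show ?thesis using assms by auto
qed

text \<open>
This is where oscillation is used. As a function of \<open>t\<close>, the composition
\<open>\<gamma> t = G (p / (t * (1 - t)))\<close> is bounded, and \<open>\<phi> p = - (h / p) * \<gamma>'\<close> with
\<open>h t = t powr (x + s) * (1 - t) powr (y + s) / (1 - 2 * t)\<close>. Integration by parts moves the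
derivative onto \<open>h\<close>, which is of size \<open>t powr Re (x + s)\<close>, with derivative of size
\<open>t powr (Re (x + s) - 1)\<close>. The bound \<open>b \<le> 1/4\<close> keeps away from the pole of \<open>h\<close> at \<open>1/2\<close>. The explicit
\<open>1 / p\<close> makes the estimate uniform for \<open>p\<close> bounded away from 0.
\<close>
lemma \<phi>_tail:
  obtains C where "C \<ge> 0"
    "\<And>p a b. p > 0 \<Longrightarrow> 0 < a \<Longrightarrow> a \<le> b \<Longrightarrow> b \<le> 1/4 \<Longrightarrow>
       norm (integral {a..b} (\<phi> p)) \<le> C / p * b powr Re (x + s)"
proof -
  define c d \<sigma> where "c = x + s" and "d = y + s" and "\<sigma> = Re (x + s)"
  define q q' h h' :: "complex \<Rightarrow> complex" where
    "q = (\<lambda>z. (1 - z) powr d / (1 - 2 * z))" and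
    "q' = (\<lambda>z. (2 * (1 - z) powr d - d * (1 - z) powr (d - 1) * (1 - 2 * z)) / (1 - 2 * z) ^ 2)" and
    "h = (\<lambda>z. z powr c * q z)" and "h' = (\<lambda>z. c * z powr (c - 1) * q z + z powr c * q' z)"
  have nz: "1 - 2 * complex_of_real t \<noteq> 0" if "t \<le> 1 / 4" for t
    using that by (auto simp: complex_eq_iff)
  have np: "1 - complex_of_real t \<notin> \<real>\<^sub>\<le>\<^sub>0" if "t \<le> 1 / 4" for t
    using that by (auto simp: complex_nonpos_Reals_iff)
  have cont_q: "continuous_on {0..1/4} (\<lambda>t::real. q (of_real t))"
    and cont_q': "continuous_on {0..1/4} (\<lambda>t::real. q' (of_real t))"
    unfolding q_def q'_def using nz np by (auto intro!: continuous_intros)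
  obtain Q where Q: "Q > 0" "\<And>t::real. t \<in> {0..1/4} \<Longrightarrow> norm (q (of_real t)) \<le> Q"
    using continuous_on_compact_norm_bound[OF cont_q compact_Icc] by blast
  obtain Q' where Q': "Q' > 0" "\<And>t::real. t \<in> {0..1/4} \<Longrightarrow> norm (q' (of_real t)) \<le> Q'"
    using continuous_on_compact_norm_bound[OF cont_q' compact_Icc] by blast
  obtain M where M: "M > 0" "\<And>v. v \<ge> 0 \<Longrightarrow> norm (G v) \<le> M" using G_bounded by blast
  define D where "D = (norm c * Q + Q') * M"
  define C where "C = D / \<sigma> + 2 * (Q * M)"
  have \<sigma>: "\<sigma> > 0" using x by (simp add: \<sigma>_def)
  have C: "C \<ge> 0" using Q Q' M \<sigma> by (auto simp: C_def D_def)
  have h_deriv: "((\<lambda>t. h (of_real t)) has_vector_derivative h' (of_real t)) (at t)"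
    if "0 < t" "t \<le> 1 / 4" for t
  proof -
    have "(q has_field_derivative q' (of_real t)) (at (of_real t))"
      unfolding q_def q'_def using nz[OF that(2)] np[OF that(2)]
      by (auto intro!: derivative_eq_intros simp: field_simps power2_eq_square)
    hence "(h has_field_derivative h' (of_real t)) (at (of_real t))"
      unfolding h_def h'_def using that
      by (auto intro!: derivative_eq_intros simp: complex_nonpos_Reals_iff)
    thus ?thesis by (rule has_vector_derivative_real_field)
  qed
  have h_bound: "norm (h (of_real t)) \<le> Q * t powr \<sigma>" if "0 < t" "t \<le> 1 / 4" for t
    using Q(2)[of t] that by (auto simp: h_def norm_mult norm_of_real_powr c_def \<sigma>_def mult.commute)
  have h'_bound: "norm (h' (of_real t)) \<le> (norm c * Q + Q') * t powr (\<sigma> - 1)" if "0 < t" "t \<le> 1 / 4" for t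
  proof -
    have "norm (h' (of_real t)) \<le> norm (c * of_real t powr (c - 1) * q t) + norm (of_real t powr c * q' t)"
      unfolding h'_def by (rule norm_triangle_ineq)
    also have "\<dots> = norm c * t powr (\<sigma> - 1) * norm (q t) + t powr \<sigma> * norm (q' t)"
      using that by (simp add: norm_mult norm_of_real_powr c_def \<sigma>_def)
    also have "\<dots> \<le> norm c * t powr (\<sigma> - 1) * Q + t powr (\<sigma> - 1) * Q'"
    proof -
      have "t powr \<sigma> \<le> t powr (\<sigma> - 1)" using that by (intro powr_mono') auto
      thus ?thesis using that Q Q' by (intro add_mono mult_mono) auto
    qed
    finally show ?thesis by (simp add: algebra_simps)
  qed
  have "norm (integral {a..b} (\<phi> p)) \<le> C / p * b powr \<sigma>"
    if p: "p > 0" and ab: "0 < a" "a \<le> b" "b \<le> 1/4" for p a b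
  proof -
    define \<gamma> where "\<gamma> = (\<lambda>t. G (p / (t * (1 - t))))"
    define F where "F = (\<lambda>t. h (of_real t) * \<gamma> t)"
    have \<gamma>_deriv: "(\<gamma> has_vector_derivative ((- p * (1 - 2 * t) / (t * (1 - t))\<^sup>2) *\<^sub>R g (p / (t * (1 - t))))) (at t)"
      if t: "0 < t" "t \<le> 1 / 4" for t
    proof -
      have w: "t * (1 - t) > 0" using w_pos[of t] t by simp
      have "((\<lambda>t. p / (t * (1 - t))) has_real_derivative (- p * (1 - 2 * t) / (t * (1 - t))\<^sup>2)) (at t)"
        using w t by (auto intro!: derivative_eq_intros simp: divide_simps power2_eq_square)
      hence "((\<lambda>t. p / (t * (1 - t))) has_vector_derivative (- p * (1 - 2 * t) / (t * (1 - t))\<^sup>2)) (at t)"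
        by (simp add: has_real_derivative_iff_has_vector_derivative)
      from vector_diff_chain_at[OF this G_has_vector_derivative] show ?thesis
        using p w by (simp add: \<gamma>_def o_def)
    qed
    have \<gamma>_bound: "norm (\<gamma> t) \<le> M" if "0 < t" "t \<le> 1 / 4" for t
      unfolding \<gamma>_def using w_pos[of t] that p by (intro M(2)) auto
    have F_deriv: "(F has_vector_derivative (h' (of_real t) * \<gamma> t - of_real p * \<phi> p t)) (at t)"
      if t: "0 < t" "t \<le> 1 / 4" for t
    proof -
      have w: "t * (1 - t) > 0" using w_pos[of t] t by simp
      have h_eq: "h (of_real t) = k t * of_real (t * (1 - t)) / (1 - 2 * of_real t)"
        using t powr_add[of "complex_of_real t" "x + s - 1" 1] powr_add[of "1 - complex_of_real t" "y + s - 1" 1] np[OF t(2)]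
        by (auto simp: h_def q_def c_def d_def k_def)
      have "h (of_real t) * ((- p * (1 - 2 * t) / (t * (1 - t))\<^sup>2) *\<^sub>R g (p / (t * (1 - t)))) = - of_real p * \<phi> p t"
        unfolding h_eq \<phi>_def scaleR_conv_of_real using w nz[OF t(2)]
        by (simp add: power2_eq_square)
      hence eq: "h (of_real t) * ((- p * (1 - 2 * t) / (t * (1 - t))\<^sup>2) *\<^sub>R g (p / (t * (1 - t)))) + h' (of_real t) * \<gamma> t
             = h' (of_real t) * \<gamma> t - of_real p * \<phi> p t"
        by simp
      show ?thesis unfolding F_def
        using has_vector_derivative_mult[OF h_deriv[OF t] \<gamma>_deriv[OF t]] unfolding eq .
    qed
    have FTC: "((\<lambda>t. h' (of_real t) * \<gamma> t - of_real p * \<phi> p t) has_integral (F b - F a)) {a..b}"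
      by (rule fundamental_theorem_of_calculus; (rule has_vector_derivative_at_within[OF F_deriv])?) (use ab in auto)
    have cont_h'\<gamma>: "continuous_on {a..b} (\<lambda>t. h' (of_real t) * \<gamma> t)"
    proof -
      have "continuous_on {a..b} \<gamma>"
        using ab by (intro continuous_at_imp_continuous_on ballI has_vector_derivative_continuous[OF \<gamma>_deriv]) auto
      moreover have "continuous_on {a..b} (\<lambda>t. h' (of_real t))"
        unfolding h'_def q_def q'_def using nz np ab
        by (auto intro!: continuous_intros simp: complex_nonpos_Reals_iff)
      ultimately show ?thesis by (intro continuous_intros)
    qed
    have "((\<lambda>t. h' (of_real t) * \<gamma> t - (h' (of_real t) * \<gamma> t - of_real p * \<phi> p t)) has_integral
        (integral {a..b} (\<lambda>t. h' (of_real t) * \<gamma> t) - (F b - F a))) {a..b}"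
      by (rule has_integral_diff[OF integrable_integral[OF integrable_continuous_interval[OF cont_h'\<gamma>]] FTC])
    hence "of_real p * integral {a..b} (\<phi> p) = integral {a..b} (\<lambda>t. h' (of_real t) * \<gamma> t) - (F b - F a)"
      by (simp add: has_integral_iff)
    hence "p * norm (integral {a..b} (\<phi> p)) = norm (integral {a..b} (\<lambda>t. h' (of_real t) * \<gamma> t) - (F b - F a))"
      using p by (metis abs_of_pos norm_mult norm_of_real)
    also have "\<dots> \<le> norm (integral {a..b} (\<lambda>t. h' (of_real t) * \<gamma> t)) + (norm (F b) + norm (F a))"
      using norm_triangle_ineq4[of "integral {a..b} (\<lambda>t. h' (of_real t) * \<gamma> t)" "F b - F a"]
            norm_triangle_ineq4[of "F b" "F a"] by linarith
    also have "\<dots> \<le> D / \<sigma> * b powr \<sigma> + (Q * b powr \<sigma> * M + Q * b powr \<sigma> * M)"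
    proof (intro add_mono)
      show "norm (integral {a..b} (\<lambda>t. h' (of_real t) * \<gamma> t)) \<le> D / \<sigma> * b powr \<sigma>"
      proof (rule norm_integral_le_powr)
        fix t assume t: "a \<le> t" "t \<le> b"
        have "norm (h' (of_real t) * \<gamma> t) \<le> ((norm c * Q + Q') * t powr (\<sigma> - 1)) * M"
          unfolding norm_mult using t ab Q Q' by (intro mult_mono h'_bound \<gamma>_bound) auto
        thus "norm (h' (of_real t) * \<gamma> t) \<le> D * t powr (\<sigma> - 1)" by (simp add: D_def mult_ac)
      qed (use ab \<sigma> cont_h'\<gamma> in auto)
      show "norm (F b) \<le> Q * b powr \<sigma> * M"
        unfolding F_def norm_mult using ab Q by (intro mult_mono h_bound \<gamma>_bound) auto
      have "norm (F a) \<le> Q * a powr \<sigma> * M"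
        unfolding F_def norm_mult using ab Q by (intro mult_mono h_bound \<gamma>_bound) auto
      also have "\<dots> \<le> Q * b powr \<sigma> * M"
        using ab Q M \<sigma> by (intro mult_mono powr_mono2) auto
      finally show "norm (F a) \<le> Q * b powr \<sigma> * M" .
    qed
    also have "\<dots> = C * b powr \<sigma>" by (simp add: C_def algebra_simps)
    finally show ?thesis using p by (simp add: field_simps)
  qed
  thus thesis using that C unfolding \<sigma>_def by blast
qed

lemma \<phi>_integral:
  obtains C where "C \<ge> 0"
    "\<And>p. p > 0 \<Longrightarrow> \<phi> p integrable_on {0..1/2}"
    "\<And>p b. p > 0 \<Longrightarrow> 0 < b \<Longrightarrow> b \<le> 1/4 \<Longrightarrow>
       norm (integral {0..1/2} (\<phi> p) - integral {b..1/2} (\<phi> p)) \<le> C / p * b powr Re (x + s)"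
proof -
  obtain C where C: "C \<ge> 0" "\<And>p a b. p > 0 \<Longrightarrow> 0 < a \<Longrightarrow> a \<le> b \<Longrightarrow> b \<le> 1/4 \<Longrightarrow>
       norm (integral {a..b} (\<phi> p)) \<le> C / p * b powr Re (x + s)"
    using \<phi>_tail by blast
  show thesis
    by (rule that[OF C(1)]; rule integrable_0_tail_bound[where ?b0.0 = "1/4", OF _ _ cont_\<phi>' x C(2)]) auto
qed

text \<open>
The result of integrating \<open>\<phi>\<close> over \<open>{0..p}\<close> in its first argument, under the integral over \<open>t\<close>. Unlike the integral of
\<open>\<phi> p\<close>, it converges absolutely.
\<close>
definition H :: "real \<Rightarrow> complex" where
  "H p = integral {0..1/2} (\<lambda>t. k t * G (p / (t * (1 - t))))"

lemma k_bound:
  obtains B where "B > 0" "\<And>t. 0 \<le> t \<Longrightarrow> t \<le> 1/2 \<Longrightarrow> norm (k t) \<le> B * t powr (Re (x + s) - 1)"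
proof -
  have "continuous_on {0..1/2} (\<lambda>t. (1 - complex_of_real t) powr (y + s - 1))"
    by (auto intro!: continuous_intros simp: complex_nonpos_Reals_iff)
  then obtain B where B: "B > 0" "\<And>t. t \<in> {0..1/2} \<Longrightarrow> norm ((1 - complex_of_real t) powr (y + s - 1)) \<le> B"
    using continuous_on_compact_norm_bound[OF _ compact_Icc] by blast
  show thesis
  proof (rule that[OF B(1)])
    fix t :: real assume t: "0 \<le> t" "t \<le> 1/2"
    have "norm (k t) = t powr (Re (x + s) - 1) * norm ((1 - complex_of_real t) powr (y + s - 1))"
      using t by (simp add: k_def norm_mult norm_of_real_powr)
    also have "\<dots> \<le> t powr (Re (x + s) - 1) * B" using B(2)[of t] t by (intro mult_left_mono) auto
    finally show "norm (k t) \<le> B * t powr (Re (x + s) - 1)" by (simp add: mult.commute)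
  qed
qed

lemma cont_kG:
  assumes "p \<ge> 0"
  shows "continuous_on {0<..1/2} (\<lambda>t. k t * G (p / (t * (1 - t))))"
proof -
  have "continuous_on {0<..1/2} (\<lambda>t. G (p / (t * (1 - t))))"
    by (rule continuous_on_compose2[OF continuous_on_G]) 
       (use assms in \<open>auto intro!: continuous_intros divide_nonneg_nonneg w_nonneg\<close>)
  thus ?thesis by (intro continuous_on_mult cont_k)
qed

lemma kG_bound:
  obtains C where "\<And>p t. p \<ge> 0 \<Longrightarrow> 0 \<le> t \<Longrightarrow> t \<le> 1/2 \<Longrightarrow>
    norm (k t * G (p / (t * (1 - t)))) \<le> C * t powr (Re (x + s) - 1)"
proof -
  obtain M where M: "M > 0" "\<And>v. v \<ge> 0 \<Longrightarrow> norm (G v) \<le> M" using G_bounded by blast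
  obtain B where B: "B > 0" "\<And>t. 0 \<le> t \<Longrightarrow> t \<le> 1/2 \<Longrightarrow> norm (k t) \<le> B * t powr (Re (x + s) - 1)"
    using k_bound by blast
  have "norm (k t * G (p / (t * (1 - t)))) \<le> (B * M) * t powr (Re (x + s) - 1)"
    if "p \<ge> 0" "0 \<le> t" "t \<le> 1 / 2" for p t
  proof -
    have "norm (k t * G (p / (t * (1 - t)))) \<le> (B * t powr (Re (x + s) - 1)) * M"
      unfolding norm_mult using that B(1)
      by (intro mult_mono M(2) B(2) divide_nonneg_nonneg w_nonneg) auto
    thus ?thesis by (simp add: mult_ac)
  qed
  thus thesis by (rule that)
qed

lemma kG_integrable:
  assumes "p \<ge> 0"
  shows "(\<lambda>t. k t * G (p / (t * (1 - t)))) integrable_on {0..1/2}"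
proof -
  obtain C where C: "\<And>p t. p \<ge> 0 \<Longrightarrow> 0 \<le> t \<Longrightarrow> t \<le> 1/2 \<Longrightarrow>
      norm (k t * G (p / (t * (1 - t)))) \<le> C * t powr (Re (x + s) - 1)"
    using kG_bound by blast
  show ?thesis
    by (rule integrable_0_powr_bound(1)[OF _ cont_kG[OF assms] x, of C]) (use C assms in auto)
qed

lemma H_tail:
  obtains C where "\<And>p b. p \<ge> 0 \<Longrightarrow> 0 < b \<Longrightarrow> b \<le> 1/2 \<Longrightarrow>
    norm (H p - integral {b..1/2} (\<lambda>t. k t * G (p / (t * (1 - t))))) \<le> C * b powr Re (x + s)"
proof -
  obtain C where C: "\<And>p t. p \<ge> 0 \<Longrightarrow> 0 \<le> t \<Longrightarrow> t \<le> 1/2 \<Longrightarrow>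
      norm (k t * G (p / (t * (1 - t)))) \<le> C * t powr (Re (x + s) - 1)"
    using kG_bound by blast
  have "norm (H p - integral {b..1/2} (\<lambda>t. k t * G (p / (t * (1 - t))))) \<le> C / Re (x + s) * b powr Re (x + s)"
    if "p \<ge> 0" "0 < b" "b \<le> 1/2" for p b
    unfolding H_def by (rule integrable_0_powr_bound(2)[OF _ cont_kG x]) (use C that in auto)
  thus thesis by (rule that)
qed

text \<open>
Leibniz' rule holds on each interval \<open>{\<epsilon>..1/2}\<close> with \<open>\<epsilon> > 0\<close>. As \<open>\<epsilon>\<close> tends to 0, the derivatives
converge uniformly for \<open>p\<close> bounded away from 0, because the neglected tails are \<open>O(\<epsilon> powr \<sigma> / p)\<close>
with \<open>\<sigma> = Re (x + s)\<close>, and so the limit may be differentiated termwise. This replaces an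
application of Fubini's theorem, for which absolute convergence is missing.
\<close>
lemma H_has_vector_derivative:
  assumes p: "p > 0"
  shows "(H has_vector_derivative integral {0..1/2} (\<phi> p)) (at p)"
proof -
  \<comment> \<open>The shift by 3 keeps the cutoffs in the range \<open>\<epsilon> \<le> 1/4\<close> of the tail estimate.\<close>
  define \<epsilon> where "\<epsilon> = (\<lambda>n::nat. inverse (real (Suc (n + 3))))"
  define Hn where "Hn = (\<lambda>n p. integral {\<epsilon> n..1/2} (\<lambda>t. k t * G (p / (t * (1 - t)))))"
  obtain C where C: "C \<ge> 0"
    "\<And>p. p > 0 \<Longrightarrow> \<phi> p integrable_on {0..1/2}"
    "\<And>p b. p > 0 \<Longrightarrow> 0 < b \<Longrightarrow> b \<le> 1/4 \<Longrightarrow>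
       norm (integral {0..1/2} (\<phi> p) - integral {b..1/2} (\<phi> p)) \<le> C / p * b powr Re (x + s)"
    using \<phi>_integral by blast
  obtain C' where C': "\<And>p b. p \<ge> 0 \<Longrightarrow> 0 < b \<Longrightarrow> b \<le> 1/2 \<Longrightarrow>
       norm (H p - integral {b..1/2} (\<lambda>t. k t * G (p / (t * (1 - t))))) \<le> C' * b powr Re (x + s)"
    using H_tail by blast
  have \<epsilon>: "0 < \<epsilon> n" "\<epsilon> n \<le> 1 / 4" for n by (auto simp: \<epsilon>_def divide_simps)
  have "\<epsilon> \<longlonglongrightarrow> 0" unfolding \<epsilon>_def
    using LIMSEQ_ignore_initial_segment[OF LIMSEQ_inverse_real_of_nat, of 3] by simp
  hence "(\<lambda>n. \<epsilon> n powr Re (x + s)) \<longlonglongrightarrow> 0"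
    using tendsto_powr'[of \<epsilon> 0 sequentially "\<lambda>_. Re (x + s)" "Re (x + s)"] x less_imp_le[OF \<epsilon>(1)] by simp
  hence \<epsilon>_lim: "(\<lambda>n. K * \<epsilon> n powr Re (x + s)) \<longlonglongrightarrow> 0" for K
    by (rule tendsto_mult_right_zero)
  have H_lim: "(\<lambda>n. Hn n r) \<longlonglongrightarrow> H r" if "r > 0" for r
  proof -
    have "(\<lambda>n. Hn n r - H r) \<longlonglongrightarrow> 0"
    proof (rule Lim_null_comparison[OF _ \<epsilon>_lim])
      have "norm (Hn n r - H r) \<le> C' * \<epsilon> n powr Re (x + s)" for n
      proof -
        have "\<epsilon> n \<le> 1 / 2" using \<epsilon>(2)[of n] by linarith
        thus ?thesis
          unfolding Hn_def by (subst norm_minus_commute) (intro C' \<epsilon>(1) less_imp_le[OF that])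
      qed
      thus "eventually (\<lambda>n. norm (Hn n r - H r) \<le> C' * \<epsilon> n powr Re (x + s)) sequentially"
        by simp
    qed
    thus ?thesis by (simp add: LIM_zero_iff)
  qed
  have Hn_deriv: "(Hn n has_vector_derivative integral {\<epsilon> n..1/2} (\<phi> r)) (at r within {p/2<..})" if r: "r \<in> {p/2<..}" for n r
  proof -
    have "((\<lambda>r. integral (cbox (\<epsilon> n) (1/2)) (\<lambda>t. k t * G (r / (t * (1 - t))))) has_vector_derivative
             integral (cbox (\<epsilon> n) (1/2)) (\<phi> r)) (at r within {p/2<..})"
    proof (rule leibniz_rule_vector_derivative[OF _ _ _ r])
      fix r t assume rt: "r \<in> {p/2<..}" "t \<in> cbox (\<epsilon> n) (1/2)"
      have w: "t * (1 - t) > 0" using rt \<epsilon>[of n] by (intro w_pos) auto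
      have r0: "r > 0" using rt p by auto
      have "((\<lambda>r. r / (t * (1 - t))) has_vector_derivative (1 / (t * (1 - t)))) (at r)"
        unfolding has_real_derivative_iff_has_vector_derivative[symmetric]
        using w by (auto intro!: derivative_eq_intros)
      from vector_diff_chain_at[OF this G_has_vector_derivative]
      have "((\<lambda>r. G (r / (t * (1 - t)))) has_vector_derivative ((1 / (t * (1 - t))) *\<^sub>R g (r / (t * (1 - t))))) (at r)"
        using w r0 by (simp add: o_def)
      hence "((\<lambda>r. k t * G (r / (t * (1 - t)))) has_vector_derivative (k t * ((1 / (t * (1 - t))) *\<^sub>R g (r / (t * (1 - t)))))) (at r)"
        by (rule has_vector_derivative_mult_right)
      moreover have "k t * ((1 / (t * (1 - t))) *\<^sub>R g (r / (t * (1 - t)))) = \<phi> r t"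
        by (simp add: \<phi>_def scaleR_conv_of_real)
      ultimately show "((\<lambda>r. k t * G (r / (t * (1 - t)))) has_vector_derivative \<phi> r t) (at r within {p/2<..})"
        by (simp add: has_vector_derivative_at_within)
    next
      fix r assume "r \<in> {p/2<..}"
      thus "(\<lambda>t. k t * G (r / (t * (1 - t)))) integrable_on cbox (\<epsilon> n) (1/2)"
        using p \<epsilon>[of n] by (intro integrable_continuous continuous_on_subset[OF cont_kG]) auto
    next
      show "continuous_on ({p/2<..} \<times> cbox (\<epsilon> n) (1/2)) (\<lambda>(r, t). \<phi> r t)"
        using p \<epsilon>[of n] by (intro continuous_on_subset[OF cont_\<phi>]) auto
    qed auto
    thus ?thesis by (simp add: Hn_def[abs_def])
  qed
  have "\<exists>F. \<forall>r\<in>{p/2<..}. (\<lambda>n. Hn n r) \<longlonglongrightarrow> F r \<and>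
          (F has_derivative (\<lambda>h. h *\<^sub>R integral {0..1/2} (\<phi> r))) (at r within {p/2<..})"
  proof (rule has_derivative_sequence[where f' = "\<lambda>n r h. h *\<^sub>R integral {\<epsilon> n..1/2} (\<phi> r)"])
    show "convex {p/2<..}" by simp
    show "(Hn n has_derivative (\<lambda>h. h *\<^sub>R integral {\<epsilon> n..1/2} (\<phi> r))) (at r within {p/2<..})"
      if "r \<in> {p/2<..}" for n r
      using Hn_deriv[OF that] by (simp add: has_vector_derivative_def)
    show "p \<in> {p/2<..}" using p by auto
    show "(\<lambda>n. Hn n p) \<longlonglongrightarrow> H p" by (rule H_lim[OF p])
    fix e :: real assume "e > 0"
    with \<epsilon>_lim[of "C / (p / 2)"] have "eventually (\<lambda>n. C / (p / 2) * \<epsilon> n powr Re (x + s) < e) sequentially"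
      by (auto dest: order_tendstoD)
    thus "\<forall>\<^sub>F n in sequentially. \<forall>r\<in>{p / 2<..}. \<forall>h. norm (h *\<^sub>R integral {\<epsilon> n..1/2} (\<phi> r) - h *\<^sub>R integral {0..1/2} (\<phi> r)) \<le> e * norm h"
    proof eventually_elim
      case (elim n)
      show ?case
      proof (intro ballI allI)
        fix r h :: real assume r: "r \<in> {p/2<..}"
        have "norm (integral {\<epsilon> n..1/2} (\<phi> r) - integral {0..1/2} (\<phi> r)) \<le> C / r * \<epsilon> n powr Re (x + s)"
          using C(3)[of r "\<epsilon> n"] r p \<epsilon>[of n] by (simp add: norm_minus_commute)
        also have "\<dots> \<le> C / (p / 2) * \<epsilon> n powr Re (x + s)"
          using C(1) p r by (intro mult_right_mono divide_left_mono) auto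
        also have "\<dots> \<le> e" using elim by simp
        finally have "\<bar>h\<bar> * norm (integral {\<epsilon> n..1/2} (\<phi> r) - integral {0..1/2} (\<phi> r)) \<le> \<bar>h\<bar> * e"
          by (intro mult_left_mono) auto
        thus "norm (h *\<^sub>R integral {\<epsilon> n..1/2} (\<phi> r) - h *\<^sub>R integral {0..1/2} (\<phi> r)) \<le> e * norm h"
          by (simp add: mult.commute flip: scaleR_diff_right)
      qed
    qed
  qed
  then obtain F where F: "\<And>r. r \<in> {p/2<..} \<Longrightarrow> (\<lambda>n. Hn n r) \<longlonglongrightarrow> F r"
    "\<And>r. r \<in> {p/2<..} \<Longrightarrow> (F has_derivative (\<lambda>h. h *\<^sub>R integral {0..1/2} (\<phi> r))) (at r within {p/2<..})"
    by blast
  have FH: "F r = H r" if "r \<in> {p/2<..}" for r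
    using LIMSEQ_unique[OF F(1)[OF that] H_lim] that p by auto
  have "(F has_vector_derivative integral {0..1/2} (\<phi> p)) (at p)"
    using F(2)[of p] p at_within_open[of p "{p/2<..}"] by (simp add: has_vector_derivative_def)
  thus ?thesis
    by (rule has_vector_derivative_transform_within_open[where S = "{p/2<..}"]) (use p FH in auto)
qed

text \<open>
Dominated convergence, with majorant a multiple of \<open>t powr (Re (x + s) - 1)\<close>. It gives both
the continuity of \<open>H\<close> down to 0 and its limit at infinity.
\<close>
lemma H_tendsto:
  assumes "\<And>n. q n \<ge> 0" and "\<And>t. t \<in> {0<..1/2} \<Longrightarrow> (\<lambda>n. G (q n / (t * (1 - t)))) \<longlonglongrightarrow> L t"
  shows "(\<lambda>n. H (q n)) \<longlonglongrightarrow> integral {0..1/2} (\<lambda>t. k t * L t)"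
proof -
  obtain C where C: "\<And>p t. p \<ge> 0 \<Longrightarrow> 0 \<le> t \<Longrightarrow> t \<le> 1/2 \<Longrightarrow>
      norm (k t * G (p / (t * (1 - t)))) \<le> C * t powr (Re (x + s) - 1)"
    using kG_bound by blast
  have int: "(\<lambda>t. C * t powr (Re (x + s) - 1)) integrable_on {0..1/2}"
    using has_integral_powr_from_0[of "Re (x + s) - 1" "1/2"] x
    by (intro integrable_on_mult_right) (auto simp: integrable_on_def)
  have "(\<lambda>n. k t * G (q n / (t * (1 - t)))) \<longlonglongrightarrow> k t * L t" if "t \<in> {0..1/2}" for t
    using assms(2)[of t] that by (cases "t = 0") (auto simp: k_0 intro!: tendsto_intros)
  thus ?thesis unfolding H_def
    by (intro dominated_convergence(2)[OF _ int] kG_integrable C assms(1)) auto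
qed

lemma continuous_on_H: "continuous_on {0..} H"
  unfolding continuous_on_sequentially o_def
proof (intro allI ballI impI, elim conjE)
  fix q :: "nat \<Rightarrow> real" and p assume q: "\<forall>n. q n \<in> {0..}" "q \<longlonglongrightarrow> p" and p: "p \<in> {0..}"
  show "(\<lambda>n. H (q n)) \<longlonglongrightarrow> H p"
    unfolding H_def[of p]
  proof (rule H_tendsto)
    fix t :: real assume t: "t \<in> {0<..1/2}"
    show "(\<lambda>n. G (q n / (t * (1 - t)))) \<longlonglongrightarrow> G (p / (t * (1 - t)))"
    proof (rule continuous_on_tendsto_compose[OF continuous_on_G])
      have "t * (1 - t) > 0" using w_pos[of t] t by auto
      thus "(\<lambda>n. q n / (t * (1 - t))) \<longlonglongrightarrow> p / (t * (1 - t))" "p / (t * (1 - t)) \<in> {0..}"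
        "eventually (\<lambda>n. q n / (t * (1 - t)) \<in> {0..}) sequentially"
        using q p by (auto intro!: tendsto_intros)
    qed
  qed (use q in auto)
qed

lemma H_at_top: "(H \<longlongrightarrow> integral {0..1/2} k * \<Psi>) at_top"
proof (rule tendsto_at_topI_sequentially)
  fix q :: "nat \<Rightarrow> real" assume q: "filterlim q at_top sequentially"
  \<comment> \<open>A sequence tending to infinity may start with negative terms, where nothing is known about \<open>H\<close>.\<close>
  have q': "filterlim (\<lambda>n. max 0 (q n)) at_top sequentially"
    by (rule filterlim_at_top_mono[OF q]) auto
  have "(\<lambda>n. H (max 0 (q n))) \<longlonglongrightarrow> integral {0..1/2} (\<lambda>t. k t * \<Psi>)"
  proof (rule H_tendsto)
    fix t :: real assume "t \<in> {0<..1/2}"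
    hence w: "t * (1 - t) > 0" using w_pos[of t] by auto
    have "filterlim (\<lambda>n. max 0 (q n) * inverse (t * (1 - t))) at_top sequentially"
      by (rule filterlim_at_top_mult_tendsto_pos[OF tendsto_const positive_imp_inverse_positive[OF w] q'])
    from filterlim_compose[OF G_tendsto this]
    show "(\<lambda>n. G (max 0 (q n) / (t * (1 - t)))) \<longlonglongrightarrow> \<Psi>" by (simp add: divide_inverse)
  qed auto
  moreover have "eventually (\<lambda>n. H (max 0 (q n)) = H (q n)) sequentially"
    using filterlim_at_top_dense[THEN iffD1, OF q, rule_format, of 0] by eventually_elim auto
  ultimately show "(\<lambda>n. H (q n)) \<longlonglongrightarrow> integral {0..1/2} k * \<Psi>"
    by (simp add: tendsto_cong)
qed

lemma \<phi>_eq: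
  assumes "p > 0" "t \<in> {0..1/2}"
  shows "\<phi> p t = of_real p powr (s - 1) *
           (of_real t powr (x - 1) * (1 - of_real t) powr (y - 1) * W (p / (t * (1 - t))))"
proof (cases "t = 0")
  case False
  define w where "w = t * (1 - t)"
  have w: "w > 0" using w_pos[of t] assms False by (auto simp: w_def)
  have t: "0 < t" "t < 1" using assms False by auto
  have "complex_of_real p powr (s - 1) = of_real (w * (p / w)) powr (s - 1)" using w by simp
  also have "\<dots> = of_real w powr (s - 1) * of_real (p / w) powr (s - 1)"
    unfolding of_real_mult by (rule powr_times_real) (use w assms in auto)
  finally have 1: "complex_of_real p powr (s - 1) = of_real w powr (s - 1) * of_real (p / w) powr (s - 1)" .
  have 2: "complex_of_real w powr (s - 1) = of_real t powr (s - 1) * (1 - of_real t) powr (s - 1)"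
    using powr_times_real[of "of_real t" "1 - of_real t" "s - 1"] t by (simp add: w_def)
  have 3: "complex_of_real t powr (x + s - 1) = of_real t powr (x - 1) * of_real t powr (s - 1) * of_real t"
    using powr_add[of "complex_of_real t" "(x - 1) + (s - 1)" 1] powr_add[of "complex_of_real t" "x - 1" "s - 1"] t
    by (simp add: algebra_simps)
  have 4: "(1 - complex_of_real t) powr (y + s - 1) = (1 - of_real t) powr (y - 1) * (1 - of_real t) powr (s - 1) * (1 - of_real t)"
    using powr_add[of "1 - complex_of_real t" "(y - 1) + (s - 1)" 1] powr_add[of "1 - complex_of_real t" "y - 1" "s - 1"] t
    by (simp add: algebra_simps)
  have nz: "complex_of_real t \<noteq> 0" "1 - complex_of_real t \<noteq> 0" using t by (auto simp: complex_eq_iff)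
  show ?thesis
    unfolding \<phi>_def k_def g_def 3 4 1 2 w_def[symmetric] using nz
    by (simp add: w_def)
qed (simp add: \<phi>_def k_0)

text \<open>
The function \<open>H\<close> vanishes at 0, tends to \<open>\<Psi>\<close> times a half Beta integral, and is a primitive of the
integrand on the left.
\<close>
theorem half_mellin:
  defines "f \<equiv> (\<lambda>p t. of_real t powr (x - 1) * (1 - of_real t) powr (y - 1) * W (p / (t * (1 - t))))"
  shows "p > 0 \<Longrightarrow> f p integrable_on {0..1/2}"
    and "((\<lambda>p. of_real p powr (s - 1) * integral {0..1/2} (f p)) has_integral
           (integral {0..1/2} (\<lambda>t. of_real t powr (x + s - 1) * (1 - of_real t) powr (y + s - 1)) * \<Psi>)) {0<..}"
proof -
  obtain C where int: "\<And>p. p > 0 \<Longrightarrow> \<phi> p integrable_on {0..1/2}" using \<phi>_integral by blast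
  show "f p integrable_on {0..1/2}" if p: "p > 0" for p
  proof -
    have "(\<lambda>t. inverse (of_real p powr (s - 1)) * \<phi> p t) integrable_on {0..1/2}"
      by (intro integrable_on_mult_right int p)
    also have "?this \<longleftrightarrow> f p integrable_on {0..1/2}"
      using p by (intro integrable_cong) (auto simp: \<phi>_eq f_def)
    finally show ?thesis .
  qed
  have "((\<lambda>p. integral {0..1/2} (\<phi> p)) has_integral (integral {0..1/2} k * \<Psi> - H 0)) {0<..}"
    by (rule has_integral_0_infinity[OF continuous_on_H H_has_vector_derivative H_at_top])
  hence "((\<lambda>p. integral {0..1/2} (\<phi> p)) has_integral (integral {0..1/2} k * \<Psi>)) {0<..}"
    by (simp add: H_def G_0)
  thus "((\<lambda>p. of_real p powr (s - 1) * integral {0..1/2} (f p)) has_integral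
           (integral {0..1/2} (\<lambda>t. of_real t powr (x + s - 1) * (1 - of_real t) powr (y + s - 1)) * \<Psi>)) {0<..}"
    unfolding k_def[abs_def]
  proof (rule has_integral_eq[rotated])
    fix p :: real assume "p \<in> {0<..}"
    hence "integral {0..1/2} (\<phi> p) = integral {0..1/2} (\<lambda>t. of_real p powr (s - 1) * f p t)"
      by (intro Henstock_Kurzweil_Integration.integral_cong) (simp add: \<phi>_eq f_def)
    thus "integral {0..1/2} (\<phi> p) = of_real p powr (s - 1) * integral {0..1/2} (f p)" by simp
  qed
qed

end
end

section \<open>The Mellin transform of the Psi-beta function\<close>

lemma has_integral_reflect_half:
  fixes f :: "real \<Rightarrow> 'a::banach"
  assumes "(f has_integral I) {0..1/2}"
  shows "((\<lambda>t. f (1 - t)) has_integral I) {1/2..1}"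
proof -
  have "(\<lambda>t::real. 1 - t) ` {0..1/2} = {1/2..1}"
    by (auto simp: image_iff intro: bexI[of _ "1 - _"])
  thus ?thesis
    using has_integral_affinity[of f I 0 "1/2" "-1" 1] assms by (simp add: image_image)
qed

theorem theorem2p1:
  fixes \<alpha> \<beta> x y s :: complex
  assumes "Re \<alpha> > -1" and "Re s > 0" and "Re (x + s) > 0" and "Re (y + s) > 0"
    and "(\<lambda>v::real. of_real v powr (s - 1) * wright \<alpha> \<beta> (- of_real v)) integrable_on {0<..}"
  shows "(\<forall>p::real. p > 0 \<longrightarrow>
           (\<lambda>t::real. of_real t powr (x - 1) * (1 - of_real t) powr (y - 1)
              * wright \<alpha> \<beta> (- (of_real p / (of_real t * (1 - of_real t))))) integrable_on {0<..<1})
       \<and> (\<lambda>p::real. of_real p powr (s - 1) * psi_beta \<alpha> \<beta> (of_real p) x y) integrable_on {0<..}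
       \<and> mellin (\<lambda>p. psi_beta \<alpha> \<beta> (of_real p) x y) s = Beta (x + s) (y + s) * psi_gamma \<alpha> \<beta> 0 s"
proof -
  define W where "W = (\<lambda>v::real. wright \<alpha> \<beta> (- of_real v))"
  define \<Psi> where "\<Psi> = psi_gamma \<alpha> \<beta> 0 s"
  have "((\<lambda>v. of_real v powr (s - 1) * W v) has_integral \<Psi>) {0<..}"
    using integrable_integral[OF assms(5)] by (simp add: W_def \<Psi>_def psi_gamma_def)
  moreover have "continuous_on {0<..} W"
    unfolding W_def by (intro continuous_on_wright assms(1) continuous_intros)
  ultimately interpret mellin_kernel W s \<Psi> by unfold_locales
  define f where "f = (\<lambda>x y p t. of_real t powr (x - 1) * (1 - of_real t) powr (y - 1) * W (p / (t * (1 - t))))"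
  define k where "k = (\<lambda>x y t. complex_of_real t powr (x + s - 1) * (1 - of_real t) powr (y + s - 1))"
  define L where "L = (\<lambda>x y p. integral {0..1/2} (f x y p))"
  have half: "p > 0 \<Longrightarrow> (f x y p has_integral L x y p) {0..1/2}"
    "((\<lambda>p. of_real p powr (s - 1) * L x y p) has_integral (integral {0..1/2} (k x y) * \<Psi>)) {0<..}"
    if "Re (x + s) > 0" for x y p
    using half_mellin[where x = x and y = y, OF that]
    by (auto simp: L_def f_def k_def intro: integrable_integral)

  \<comment> \<open>Reflecting \<open>{0..1/2}\<close> exchanges \<open>x\<close> and \<open>y\<close> and preserves \<open>t * (1 - t)\<close>.\<close>
  have f_int: "(f x y p has_integral (L x y p + L y x p)) {0<..<1}" if p: "p > 0" for p
  proof -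
    have "(f x y p has_integral L x y p) {0..1/2}" "(f y x p has_integral L y x p) {0..1/2}"
      by (auto intro!: half(1) assms p)
    moreover from has_integral_reflect_half[OF this(2)] have "(f x y p has_integral L y x p) {1/2..1}"
      by (simp add: f_def mult_ac)
    ultimately have "(f x y p has_integral (L x y p + L y x p)) {0..1}"
      by (intro has_integral_combine[of 0 "1/2" 1]) auto
    thus ?thesis by (simp add: has_integral_Icc_iff_Ioo)
  qed
  have f_eq: "f x y p t = of_real t powr (x - 1) * (1 - of_real t) powr (y - 1)
              * wright \<alpha> \<beta> (- (of_real p / (of_real t * (1 - of_real t))))" for p t
    by (simp add: f_def W_def)
  have psi_beta: "psi_beta \<alpha> \<beta> (of_real p) x y = L x y p + L y x p" if "p > 0" for p
    using f_int[OF that] unfolding psi_beta_def f_eq[symmetric] by (simp add: integral_unique)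

  have k_int: "(k x y has_integral Beta (x + s) (y + s)) {0..1}" if "Re (x + s) > 0" "Re (y + s) > 0" for x y
    using has_integral_Beta_complex[OF that] by (simp add: has_integral_Icc_iff_Ioo k_def)
  have k_half: "(k x y has_integral integral {0..1/2} (k x y)) {0..1/2}"
    if "Re (x + s) > 0" "Re (y + s) > 0" for x y
    by (rule integrable_integral, rule integrable_on_subinterval[OF has_integral_integrable[OF k_int[OF that]]]) auto
  have "(k x y has_integral integral {0..1/2} (k y x)) {1/2..1}"
    using has_integral_reflect_half[OF k_half[OF assms(4,3)]] by (simp add: k_def mult_ac)
  hence "(k x y has_integral (integral {0..1/2} (k x y) + integral {0..1/2} (k y x))) {0..1}"
    using k_half[OF assms(3,4)] by (intro has_integral_combine[of 0 "1/2" 1]) auto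
  hence Beta: "Beta (x + s) (y + s) = integral {0..1/2} (k x y) + integral {0..1/2} (k y x)"
    by (rule has_integral_unique[OF k_int[OF assms(3,4)]])

  have "((\<lambda>p. of_real p powr (s - 1) * L x y p + of_real p powr (s - 1) * L y x p) has_integral
          (integral {0..1/2} (k x y) * \<Psi> + integral {0..1/2} (k y x) * \<Psi>)) {0<..}"
    by (intro has_integral_add half(2) assms)
  hence "((\<lambda>p. of_real p powr (s - 1) * psi_beta \<alpha> \<beta> (of_real p) x y) has_integral
          Beta (x + s) (y + s) * \<Psi>) {0<..}"
    unfolding Beta distrib_right[symmetric]
    by (rule has_integral_eq[rotated]) (simp add: psi_beta distrib_left)
  thus ?thesis
    using f_int unfolding f_eq[symmetric] mellin_def \<Psi>_def by (auto simp: has_integral_iff)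
qed

end
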